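(* Let $\lambda\in\mathcal X^{++}$. The map $\tilde a_{\ge0}:V^\bullet(K)-\{0\}\to P^\bullet(K)$ (which sends a rational map $f$ to the rational map $t\mapsto\mathbf Cf(t)$) is surjective. It induces a bijection $(V^\bullet(K)-\{0\})/K\to P^\bullet(K)$, where the quotient is by the scalar multiplication action of the multiplicative group of the semifield $K$.
   Context: $G$ is a connected semisimple simply connected algebraic group over $\mathbf C$ of simply laced type with a fixed pinning (in particular a Borel subgroup $B^+$ and a maximal torus $T$ of $B^+$); $\mathcal X^{++}$ is the set of characters $\lambda$ of $T$ with $\langle i,\lambda\rangle\ge1$ for every simple coroot $i$. $V$ is the simple $G$-module over $\mathbf C$ with highest weight $\lambda$, $V_\lambda$ its highest weight line, and $\beta$ its canonical basis (Lusztig's canonical basis specialized at $q=1$, containing a fixed highest weight vector). $V_{\ge0}$ is the set of vectors of $V$ all of whose coordinates in the basis $\beta$ are in $\mathbf R_{\ge0}$. $P^\bullet$ is the closed subvariety of the projective space of lines in $V$ consisting of the lines $gV_\lambda$, $g\in G$; $V^\bullet=\bigcup_{L\in P^\bullet}L\subset V$. $V^\bullet_{\ge0}=V^\bullet\cap V_{\ge0}$, and $P^\bullet_{\ge0}$ is the set of $L\in P^\bullet$ containing a nonzero vector of $V_{\ge0}$. For an algebraic variety $X$ over $\mathbf C$ with a given subset $X_{\ge0}$, $\tilde X$ is the set of rational maps $f:\mathbf C\rightharpoondown X$ (equivalence classes of morphisms $f_U:U\to X$ with $U\subset\mathbf C$ nonempty open, two such being equivalent if they agree on the intersection of their domains),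 and $\tilde X_{\ge0}$ is the set of $f\in\tilde X$ such that for some $U$ on which $f$ is defined and some $\epsilon\in\mathbf R_{>0}$ we have $(0,\epsilon)\subset U$ and $f(t)\in X_{\ge0}$ for all $t\in(0,\epsilon)$. Put $V^\bullet(K)=\widetilde{V^\bullet}_{\ge0}$ (with $X=V^\bullet$, $X_{\ge0}=V^\bullet_{\ge0}$) and $P^\bullet(K)=\widetilde{P^\bullet}_{\ge0}$ (with $X=P^\bullet$, $X_{\ge0}=P^\bullet_{\ge0}$). Here $0\in V^\bullet(K)$ is the zero map. $K$ is the semifield of all rational functions in $\mathbf R(x)$ of the form $x^ef_1/f_2$ with $e\in\mathbf Z$ and $f_1,f_2\in\mathbf R[x]$ having constant term in $\mathbf R_{>0}$ (usual sum and product); equivalently, $K$ is the set of nonzero rational functions on $\mathbf C$ which take values in $\mathbf R_{>0}$ on $(0,\epsilon)$ for some $\epsilon>0$. Its multiplicative group acts freely on $V^\bullet(K)-\{0\}$ by pointwise scalar multiplication. *)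

theory Defs
  imports
    "HOL-Analysis.Analysis"
    "HOL-Algebra.Group_Action"
    "HOL-Algebra.Solvable_Groups"
    "HOL-Algebra.FiniteProduct"
    "HOL-Computational_Algebra.Polynomial_Factorial"
    "HOL-Library.Poly_Mapping"
begin

section \<open>Linear algebraic groups over the complex numbers\<close>

text \<open>A linear algebraic group is a Zariski closed subgroup of some general linear group.\<close>

inductive matrix_poly :: "(complex^'n^'n \<Rightarrow> complex) \<Rightarrow> bool" where
  const: "matrix_poly (\<lambda>_. c)"
| entry: "matrix_poly (\<lambda>A. A $ i $ j)"
| add: "matrix_poly p \<Longrightarrow> matrix_poly q \<Longrightarrow> matrix_poly (\<lambda>A. p A + q A)"
| mult: "matrix_poly p \<Longrightarrow> matrix_poly q \<Longrightarrow> matrix_poly (\<lambda>A. p A * q A)"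

definition mat_group :: "(complex^'n^'n) set \<Rightarrow> (complex^'n^'n) monoid" where
  "mat_group H = \<lparr>carrier = H, mult = (**), one = mat 1\<rparr>"

definition GL :: "(complex^'n^'n) set" where
  "GL = {A. invertible A}"

definition zariski_closed :: "(complex^'n^'n) set \<Rightarrow> bool" where
  "zariski_closed Z \<longleftrightarrow> (\<exists>P. (\<forall>p\<in>P. matrix_poly p) \<and> Z = {A \<in> GL. \<forall>p\<in>P. p A = 0})"

definition algebraic_group :: "(complex^'n^'n) set \<Rightarrow> bool" where
  "algebraic_group H \<longleftrightarrow> subgroup H (mat_group GL) \<and> zariski_closed H"

definition zariski_connected :: "(complex^'n^'n) set \<Rightarrow> bool" where
  "zariski_connected H \<longleftrightarrow>
     \<not> (\<exists>Z1 Z2. zariski_closed Z1 \<and> zariski_closed Z2 \<and> Z1 \<noteq> {} \<and> Z2 \<noteq> {} \<and>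
          Z1 \<inter> Z2 = {} \<and> H = Z1 \<union> Z2)"

definition regular_on :: "(complex^'n^'n) set \<Rightarrow> (complex^'n^'n \<Rightarrow> complex) \<Rightarrow> bool" where
  "regular_on H f \<longleftrightarrow> (\<exists>p k. matrix_poly p \<and> (\<forall>A\<in>H. f A = p A / det A ^ k))"

definition algebraic_hom ::
  "(complex^'n^'n) set \<Rightarrow> (complex^'m^'m) set \<Rightarrow> (complex^'n^'n \<Rightarrow> complex^'m^'m) \<Rightarrow> bool" where
  "algebraic_hom H H' \<phi> \<longleftrightarrow>
     \<phi> \<in> hom (mat_group H) (mat_group H') \<and> (\<forall>i j. regular_on H (\<lambda>A. \<phi> A $ i $ j))"

text \<open>The radical, i.e. the largest connected solvable normal closed subgroup, is trivial.\<close>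

definition connected_semisimple :: "(complex^'n^'n) set \<Rightarrow> bool" where
  "connected_semisimple G \<longleftrightarrow> algebraic_group G \<and> zariski_connected G \<and>
     (\<forall>R. algebraic_group R \<and> zariski_connected R \<and> R \<lhd> mat_group G \<and> solvable (mat_group R)
        \<longrightarrow> R = {mat 1})"

definition borel_in :: "(complex^'n^'n) set \<Rightarrow> (complex^'n^'n) set \<Rightarrow> bool" where
  "borel_in G B \<longleftrightarrow>
     (let bs = {H. H \<subseteq> G \<and> algebraic_group H \<and> zariski_connected H \<and> solvable (mat_group H)}
      in B \<in> bs \<and> (\<forall>H\<in>bs. B \<subseteq> H \<longrightarrow> H = B))"

definition torus :: "(complex^'n^'n) set \<Rightarrow> bool" where
  "torus T \<longleftrightarrow> algebraic_group T \<and> zariski_connected T \<and>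
     (\<exists>Q\<in>GL. \<forall>t\<in>T. \<forall>i j. i \<noteq> j \<longrightarrow> (Q ** t ** matrix_inv Q) $ i $ j = 0)"

definition maximal_torus_in :: "(complex^'n^'n) set \<Rightarrow> (complex^'n^'n) set \<Rightarrow> bool" where
  "maximal_torus_in H T \<longleftrightarrow> T \<subseteq> H \<and> torus T \<and>
     (\<forall>T'. T' \<subseteq> H \<and> torus T' \<and> T \<subseteq> T' \<longrightarrow> T' = T)"

definition characters :: "(complex^'n^'n) set \<Rightarrow> (complex^'n^'n \<Rightarrow> complex) set" where
  "characters T = {c \<in> T \<rightarrow>\<^sub>E (UNIV - {0}). regular_on T c \<and> (\<forall>s\<in>T. \<forall>t\<in>T. c (s ** t) = c s * c t)}"

text \<open>Regular functions on the multiplicative group are the Laurent polynomials.\<close>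

definition cocharacters :: "(complex^'n^'n) set \<Rightarrow> (complex \<Rightarrow> complex^'n^'n) set" where
  "cocharacters T = {h \<in> (UNIV - {0}) \<rightarrow> T.
     (\<forall>c d. c \<noteq> 0 \<longrightarrow> d \<noteq> 0 \<longrightarrow> h (c * d) = h c ** h d) \<and>
     (\<forall>i j. \<exists>p k. \<forall>c. c \<noteq> 0 \<longrightarrow> h c $ i $ j = poly p c / c ^ k)}"

definition pairing :: "(complex \<Rightarrow> complex^'n^'n) \<Rightarrow> (complex^'n^'n \<Rightarrow> complex) \<Rightarrow> int" where
  "pairing h c = (THE m. \<forall>z. z \<noteq> 0 \<longrightarrow> c (h z) = z powi m)"

text \<open>The Lie algebra, as the Zariski tangent space at the identity.\<close>

definition mscale :: "complex \<Rightarrow> complex^'n^'n \<Rightarrow> complex^'n^'n" where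
  "mscale c X = (\<chi> i j. c * X $ i $ j)"

definition lie_algebra :: "(complex^'n^'n) set \<Rightarrow> (complex^'n^'n) set" where
  "lie_algebra H =
     {X. \<forall>p. matrix_poly p \<and> (\<forall>A\<in>H. p A = 0) \<longrightarrow> deriv (\<lambda>s. p (mat 1 + mscale s X)) 0 = 0}"

definition roots_of ::
  "(complex^'n^'n) set \<Rightarrow> (complex^'n^'n) set \<Rightarrow> (complex^'n^'n \<Rightarrow> complex) set" where
  "roots_of T H = {c \<in> characters T. (\<exists>t\<in>T. c t \<noteq> 1) \<and>
     (\<exists>X\<in>lie_algebra H. X \<noteq> 0 \<and> (\<forall>t\<in>T. t ** X ** matrix_inv t = mscale (c t) X))}"

definition simple_roots ::
  "(complex^'n^'n) set \<Rightarrow> (complex^'n^'n) set \<Rightarrow> (complex^'n^'n \<Rightarrow> complex) set" where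
  "simple_roots T B = {c \<in> roots_of T B.
     \<not> (\<exists>c1\<in>roots_of T B. \<exists>c2\<in>roots_of T B. \<forall>t\<in>T. c t = c1 t * c2 t)}"

section \<open>Pinnings\<close>

definition SL2 :: "(complex^2^2) set" where
  "SL2 = {A. det A = 1}"

text \<open>
  The index set of the simple roots is \<open>I\<close>; for \<open>i \<in> I\<close>, \<open>\<alpha> i\<close> is the simple root, \<open>h i\<close> the
  simple coroot, and \<open>x i\<close>, \<open>y i\<close> are the simple root homomorphisms, which extend to a
  homomorphism from \<open>SL\<^sub>2\<close>.
\<close>

definition pinning ::
  "(complex^'n^'n) set \<Rightarrow> (complex^'n^'n) set \<Rightarrow> (complex^'n^'n) set \<Rightarrow> 'i set \<Rightarrow>
   ('i \<Rightarrow> complex^'n^'n \<Rightarrow> complex) \<Rightarrow> ('i \<Rightarrow> complex \<Rightarrow> complex^'n^'n) \<Rightarrow>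
   ('i \<Rightarrow> complex \<Rightarrow> complex^'n^'n) \<Rightarrow> ('i \<Rightarrow> complex \<Rightarrow> complex^'n^'n) \<Rightarrow> bool" where
  "pinning G B T I \<alpha> h x y \<longleftrightarrow>
     borel_in G B \<and> T \<subseteq> B \<and> maximal_torus_in G T \<and>
     finite I \<and> bij_betw \<alpha> I (simple_roots T B) \<and>
     (\<forall>i\<in>I. h i \<in> cocharacters T \<and> x i 1 \<noteq> mat 1 \<and>
        (\<exists>\<phi>. algebraic_hom SL2 G \<phi> \<and>
           (\<forall>a. x i a = \<phi> (vector [vector [1, a], vector [0, 1]])) \<and>
           (\<forall>a. y i a = \<phi> (vector [vector [1, 0], vector [a, 1]])) \<and>
           (\<forall>c. c \<noteq> 0 \<longrightarrow> h i c = \<phi> (vector [vector [c, 0], vector [0, inverse c]]))) \<and>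
        (\<forall>t\<in>T. \<forall>a. t ** x i a ** matrix_inv t = x i (\<alpha> i t * a) \<and>
                   t ** y i a ** matrix_inv t = y i (inverse (\<alpha> i t) * a)))"

definition cartan_matrix ::
  "('i \<Rightarrow> complex^'n^'n \<Rightarrow> complex) \<Rightarrow> ('i \<Rightarrow> complex \<Rightarrow> complex^'n^'n) \<Rightarrow> 'i \<Rightarrow> 'i \<Rightarrow> int" where
  "cartan_matrix \<alpha> h i j = pairing (h i) (\<alpha> j)"

definition simply_laced :: "'i set \<Rightarrow> ('i \<Rightarrow> 'i \<Rightarrow> int) \<Rightarrow> bool" where
  "simply_laced I a \<longleftrightarrow> (\<forall>i\<in>I. \<forall>j\<in>I. i \<noteq> j \<longrightarrow> a i j \<in> {0, -1})"

text \<open>Simply connected means that the cocharacter group of the torus is generated by the simple coroots.\<close>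

definition simply_connected_type ::
  "(complex^'n^'n) set \<Rightarrow> 'i set \<Rightarrow> ('i \<Rightarrow> complex \<Rightarrow> complex^'n^'n) \<Rightarrow> bool" where
  "simply_connected_type T I h \<longleftrightarrow>
     (\<forall>k\<in>cocharacters T. \<exists>m :: 'i \<Rightarrow> int. \<forall>c. c \<noteq> 0 \<longrightarrow>
        k c = finprod (mat_group T) (\<lambda>i. h i (c powi m i)) I)"

definition dominant_regular ::
  "(complex^'n^'n) set \<Rightarrow> 'i set \<Rightarrow> ('i \<Rightarrow> complex \<Rightarrow> complex^'n^'n) \<Rightarrow>
   (complex^'n^'n \<Rightarrow> complex) set" where
  "dominant_regular T I h = {c \<in> characters T. \<forall>i\<in>I. pairing (h i) c \<ge> 1}"

section \<open>Simple modules\<close>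

definition simple_module ::
  "(complex^'n^'n) set \<Rightarrow> (complex^'n^'n \<Rightarrow> complex^'d^'d) \<Rightarrow> bool" where
  "simple_module G \<rho> \<longleftrightarrow> algebraic_hom G GL \<rho> \<and>
     (\<forall>W. vec.subspace W \<and> (\<forall>g\<in>G. \<forall>w\<in>W. \<rho> g *v w \<in> W) \<longrightarrow> W = {0} \<or> W = UNIV)"

definition highest_weight_vector ::
  "(complex^'n^'n) set \<Rightarrow> (complex^'n^'n) set \<Rightarrow> (complex^'n^'n \<Rightarrow> complex^'d^'d) \<Rightarrow>
   (complex^'n^'n \<Rightarrow> complex) \<Rightarrow> complex^'d \<Rightarrow> bool" where
  "highest_weight_vector B T \<rho> lam \<eta> \<longleftrightarrow> \<eta> \<noteq> 0 \<and>
     (\<forall>b\<in>B. \<rho> b *v \<eta> \<in> vec.span {\<eta>}) \<and> (\<forall>t\<in>T. \<rho> t *v \<eta> = lam t *s \<eta>)"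

text \<open>The Chevalley generator of the Lie algebra attached to \<open>y i\<close>, acting on the module.\<close>

definition chevalley_f ::
  "(complex^'n^'n \<Rightarrow> complex^'d^'d) \<Rightarrow> ('i \<Rightarrow> complex \<Rightarrow> complex^'n^'n) \<Rightarrow> 'i \<Rightarrow> complex^'d^'d" where
  "chevalley_f \<rho> y i = (\<chi> r s. deriv (\<lambda>a. \<rho> (y i a) $ r $ s) 0)"

section \<open>The canonical basis\<close>

text \<open>
  This follows Lusztig, Introduction to Quantum Groups, Chapters 1 and 14, for a simply laced
  Cartan matrix \<open>a\<close> (so that \<open>i \<cdot> j = a i j\<close> and \<open>v\<^sub>i = v\<close>). The algebra \<open>f\<close> over the field of
  rational functions in \<open>v\<close> is the quotient of the free algebra on \<open>\<theta>\<^sub>i\<close>, \<open>i \<in> I\<close>, by the radical of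
  Lusztig's bilinear form. We work with representatives in the free algebra, whose elements are
  finitely supported functions on words.
\<close>

type_synonym ratfun = "int poly fract"
type_synonym 'i free_alg = "'i list \<Rightarrow>\<^sub>0 ratfun"

definition vv :: ratfun where
  "vv = Fract [:0, 1:] 1"

definition laurent :: "ratfun set" where
  "laurent = {Fract p 1 / vv ^ k | p k. True}"

definition qint :: "nat \<Rightarrow> ratfun" where
  "qint n = (\<Sum>k<n. vv powi (int n - 1 - 2 * int k))"

definition qfact :: "nat \<Rightarrow> ratfun" where
  "qfact n = (\<Prod>k=1..n. qint k)"

text \<open>The field involution with \<open>v \<mapsto> v\<^sup>-\<^sup>1\<close>, and the substitution \<open>v = 1\<close> for rational functions
  regular there (\<open>quot_of_fract\<close> gives a fraction in lowest terms).\<close>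

definition bar :: "ratfun \<Rightarrow> ratfun" where
  "bar c = (case quot_of_fract c of (p, q) \<Rightarrow>
     poly (map_poly of_int p) (inverse vv) / poly (map_poly of_int q) (inverse vv))"

definition at_one :: "ratfun \<Rightarrow> complex" where
  "at_one c = (case quot_of_fract c of (p, q) \<Rightarrow> of_int (poly p 1) / of_int (poly q 1))"

text \<open>The set \<open>1 + v\<^sup>-\<^sup>1 (\<rat>[[v\<^sup>-\<^sup>1]] \<inter> \<rat>(v))\<close>.\<close>

definition one_at_infinity :: "ratfun set" where
  "one_at_infinity = {1 + Fract r q | r q. q \<noteq> 0 \<and> (r = 0 \<or> degree r < degree q)}"

definition free_scale :: "ratfun \<Rightarrow> 'i free_alg \<Rightarrow> 'i free_alg" where
  "free_scale c = Poly_Mapping.map (\<lambda>d. c * d)"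

definition free_bar :: "'i free_alg \<Rightarrow> 'i free_alg" where
  "free_bar = Poly_Mapping.map bar"

definition free_one :: "'i free_alg" where
  "free_one = Poly_Mapping.single [] 1"

definition theta_mult :: "'i \<Rightarrow> 'i free_alg \<Rightarrow> 'i free_alg" where
  "theta_mult i z = (\<Sum>w\<in>Poly_Mapping.keys z. Poly_Mapping.single (i # w) (Poly_Mapping.lookup z w))"

definition divpow_mult :: "'i \<Rightarrow> nat \<Rightarrow> 'i free_alg \<Rightarrow> 'i free_alg" where
  "divpow_mult i n z = free_scale (inverse (qfact n)) ((theta_mult i ^^ n) z)"

definition free_on :: "'i set \<Rightarrow> 'i free_alg set" where
  "free_on I = {z. \<forall>w\<in>Poly_Mapping.keys z. set w \<subseteq> I}"

text \<open>The subalgebra over \<open>\<int>[v, v\<^sup>-\<^sup>1]\<close> generated by the divided powers.\<close>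

inductive_set integral_form :: "'i set \<Rightarrow> 'i free_alg set" for I where
  one: "free_one \<in> integral_form I"
| divpow: "z \<in> integral_form I \<Longrightarrow> i \<in> I \<Longrightarrow> divpow_mult i n z \<in> integral_form I"
| add: "z \<in> integral_form I \<Longrightarrow> z' \<in> integral_form I \<Longrightarrow> z + z' \<in> integral_form I"
| scale: "z \<in> integral_form I \<Longrightarrow> c \<in> laurent \<Longrightarrow> free_scale c z \<in> integral_form I"

text \<open>
  The bilinear form on words: \<open>(\<theta>\<^sub>i z, u) = (1 - v\<^sup>-\<^sup>2)\<^sup>-\<^sup>1 (z, r\<^sub>i u)\<close>, where \<open>r\<^sub>i\<close> is the twisted
  derivation with \<open>r\<^sub>i (\<theta>\<^sub>j u) = \<delta>\<^sub>i\<^sub>j u + v\<^sup>i\<^sup>\<cdot>\<^sup>j \<theta>\<^sub>j r\<^sub>i u\<close>.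
\<close>

primrec word_form :: "('i \<Rightarrow> 'i \<Rightarrow> int) \<Rightarrow> 'i list \<Rightarrow> 'i list \<Rightarrow> ratfun" where
  "word_form a [] u = (if u = [] then 1 else 0)"
| "word_form a (i # w) u = inverse (1 - vv powi (-2)) *
     (\<Sum>k \<in> {k. k < length u \<and> u ! k = i}.
        vv powi (\<Sum>l<k. a i (u ! l)) * word_form a w (take k u @ drop (Suc k) u))"

definition lusztig_form :: "('i \<Rightarrow> 'i \<Rightarrow> int) \<Rightarrow> 'i free_alg \<Rightarrow> 'i free_alg \<Rightarrow> ratfun" where
  "lusztig_form a z u =
     (\<Sum>w\<in>Poly_Mapping.keys z. \<Sum>w'\<in>Poly_Mapping.keys u. Poly_Mapping.lookup z w * Poly_Mapping.lookup u w' * word_form a w w')"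

definition radical :: "'i set \<Rightarrow> ('i \<Rightarrow> 'i \<Rightarrow> int) \<Rightarrow> 'i free_alg set" where
  "radical I a = {z \<in> free_on I. \<forall>u\<in>free_on I. lusztig_form a z u = 0}"

text \<open>Membership of the class of \<open>z\<close> in the right ideal \<open>\<theta>\<^sub>i\<^sup>n f\<close>.\<close>

definition in_theta_ideal :: "'i set \<Rightarrow> ('i \<Rightarrow> 'i \<Rightarrow> int) \<Rightarrow> 'i \<Rightarrow> nat \<Rightarrow> 'i free_alg \<Rightarrow> bool" where
  "in_theta_ideal I a i n z \<longleftrightarrow> (\<exists>u\<in>free_on I. z - (theta_mult i ^^ n) u \<in> radical I a)"

text \<open>Integral representatives of the elements of the signed basis (the canonical basis up to sign).\<close>

definition signed_basis :: "'i set \<Rightarrow> ('i \<Rightarrow> 'i \<Rightarrow> int) \<Rightarrow> 'i free_alg set" where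
  "signed_basis I a = {z \<in> integral_form I.
     (\<forall>w\<in>Poly_Mapping.keys z. \<forall>w'\<in>Poly_Mapping.keys z. mset w = mset w') \<and>
     free_bar z - z \<in> radical I a \<and> lusztig_form a z z \<in> one_at_infinity}"

text \<open>
  The choice of signs: for \<open>n > 0\<close> and \<open>z\<close> in the canonical basis but not in \<open>\<theta>\<^sub>i f\<close>, the
  element \<open>z'\<close> of the signed basis in \<open>\<theta>\<^sub>i\<^sup>n f\<close> but not in \<open>\<theta>\<^sub>i\<^sup>n\<^sup>+\<^sup>1 f\<close> that is congruent to
  \<open>\<theta>\<^sub>i\<^sup>(\<^sup>n\<^sup>) z\<close> modulo \<open>\<theta>\<^sub>i\<^sup>n\<^sup>+\<^sup>1 f\<close> is in the canonical basis, and all elements of positive degree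
  arise in this way.
\<close>

inductive_set canonical_reps :: "'i set \<Rightarrow> ('i \<Rightarrow> 'i \<Rightarrow> int) \<Rightarrow> 'i free_alg set" for I a where
  one: "free_one \<in> canonical_reps I a"
| step: "z \<in> canonical_reps I a \<Longrightarrow> i \<in> I \<Longrightarrow> n > 0 \<Longrightarrow> \<not> in_theta_ideal I a i 1 z \<Longrightarrow>
     z' \<in> signed_basis I a \<Longrightarrow>
     in_theta_ideal I a i n z' \<Longrightarrow> \<not> in_theta_ideal I a i (Suc n) z' \<Longrightarrow>
     in_theta_ideal I a i (Suc n) (divpow_mult i n z - z') \<Longrightarrow> z' \<in> canonical_reps I a"

text \<open>
  The action of an element of the integral form at \<open>v = 1\<close> on a vector, \<open>\<theta>\<^sub>i\<close> acting by \<open>F i\<close>. The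
  coefficients of words have only quantum factorials and powers of \<open>v\<close> in the denominator, so they
  are regular at \<open>v = 1\<close>.
\<close>

definition specialize :: "('i \<Rightarrow> complex^'d^'d) \<Rightarrow> complex^'d \<Rightarrow> 'i free_alg \<Rightarrow> complex^'d" where
  "specialize F \<eta> z = (\<Sum>w\<in>Poly_Mapping.keys z. at_one (Poly_Mapping.lookup z w) *s foldr (\<lambda>i u. F i *v u) w \<eta>)"

text \<open>
  The canonical basis of the simple module with highest weight vector \<open>\<eta>\<close> consists of the nonzero
  vectors \<open>b \<eta>\<close> with \<open>b\<close> in the canonical basis of \<open>f\<close>, at \<open>v = 1\<close>. By Lusztig's theorem this set is
  a basis of the module; that fact is recorded in the definition.
\<close>

definition canonical_basis ::
  "'i set \<Rightarrow> ('i \<Rightarrow> 'i \<Rightarrow> int) \<Rightarrow> ('i \<Rightarrow> complex^'d^'d) \<Rightarrow> complex^'d \<Rightarrow> (complex^'d) set \<Rightarrow> bool" where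
  "canonical_basis I a F \<eta> \<beta> \<longleftrightarrow>
     \<beta> = specialize F \<eta> ` canonical_reps I a - {0} \<and>
     vec.independent \<beta> \<and> vec.span \<beta> = UNIV"

section \<open>The varieties and their nonnegative parts\<close>

definition V_nonneg :: "(complex^'d) set \<Rightarrow> (complex^'d) set" where
  "V_nonneg \<beta> = {u. \<forall>b\<in>\<beta>. vec.representation \<beta> u b \<in> \<real>\<^sub>\<ge>\<^sub>0}"

definition P_bullet ::
  "(complex^'n^'n) set \<Rightarrow> (complex^'n^'n \<Rightarrow> complex^'d^'d) \<Rightarrow> complex^'d \<Rightarrow> (complex^'d) set set" where
  "P_bullet G \<rho> \<eta> = {(\<lambda>u. \<rho> g *v u) ` vec.span {\<eta>} | g. g \<in> G}"

definition V_bullet ::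
  "(complex^'n^'n) set \<Rightarrow> (complex^'n^'n \<Rightarrow> complex^'d^'d) \<Rightarrow> complex^'d \<Rightarrow> (complex^'d) set" where
  "V_bullet G \<rho> \<eta> = \<Union> (P_bullet G \<rho> \<eta>)"

definition V_bullet_nonneg where
  "V_bullet_nonneg G \<rho> \<eta> \<beta> = V_bullet G \<rho> \<eta> \<inter> V_nonneg \<beta>"

definition P_bullet_nonneg where
  "P_bullet_nonneg G \<rho> \<eta> \<beta> = {L \<in> P_bullet G \<rho> \<eta>. \<exists>u\<in>L. u \<noteq> 0 \<and> u \<in> V_nonneg \<beta>}"

section \<open>Rational maps from the affine line\<close>

text \<open>The nonempty Zariski open subsets of the affine line are the cofinite ones.\<close>

definition zopen :: "complex set \<Rightarrow> bool" where
  "zopen U \<longleftrightarrow> finite (- U)"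

definition regular_function :: "complex set \<Rightarrow> (complex \<Rightarrow> complex) \<Rightarrow> bool" where
  "regular_function U f \<longleftrightarrow>
     (\<forall>t0\<in>U. \<exists>p q. poly q t0 \<noteq> 0 \<and> (\<forall>t\<in>U. poly q t \<noteq> 0 \<longrightarrow> f t = poly p t / poly q t))"

text \<open>Morphisms to a closed subvariety of a vector space, and to a closed subvariety of the space of
  lines (locally given by homogeneous coordinates which are polynomials).\<close>

definition affine_morphism :: "complex set \<Rightarrow> (complex \<Rightarrow> complex^'d) \<Rightarrow> bool" where
  "affine_morphism U f \<longleftrightarrow> (\<forall>j. regular_function U (\<lambda>t. f t $ j))"

definition projective_morphism :: "complex set \<Rightarrow> (complex \<Rightarrow> (complex^'d) set) \<Rightarrow> bool" where
  "projective_morphism U f \<longleftrightarrow>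
     (\<forall>t0\<in>U. \<exists>p :: 'd \<Rightarrow> complex poly. (\<chi> j. poly (p j) t0) \<noteq> 0 \<and>
        (\<forall>t\<in>U. (\<chi> j. poly (p j) t) \<noteq> 0 \<longrightarrow> f t = vec.span {\<chi> j. poly (p j) t}))"

text \<open>
  In a pair \<open>(U, f)\<close> only the restriction of \<open>f\<close> to \<open>U\<close> matters. The parameter \<open>mor\<close> tells which
  maps to the ambient space are morphisms.
\<close>

definition rat_reps ::
  "(complex set \<Rightarrow> (complex \<Rightarrow> 'x) \<Rightarrow> bool) \<Rightarrow> 'x set \<Rightarrow> (complex set \<times> (complex \<Rightarrow> 'x)) set" where
  "rat_reps mor X = {(U, f). zopen U \<and> f \<in> U \<rightarrow> X \<and> mor U f}"

definition rat_rel where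
  "rat_rel mor X = {((U, f), (U', f')). (U, f) \<in> rat_reps mor X \<and> (U', f') \<in> rat_reps mor X \<and>
     (\<forall>t\<in>U \<inter> U'. f t = f' t)}"

definition rational_maps where
  "rational_maps mor X = rat_reps mor X // rat_rel mor X"

definition rational_maps_nonneg where
  "rational_maps_nonneg mor X Xnn = {F \<in> rational_maps mor X.
     \<exists>(U, f)\<in>F. \<exists>\<epsilon>>0. \<forall>s::real. 0 < s \<and> s < \<epsilon> \<longrightarrow> of_real s \<in> U \<and> f (of_real s) \<in> Xnn}"

definition V_bullet_K where
  "V_bullet_K G \<rho> \<eta> \<beta> =
     rational_maps_nonneg affine_morphism (V_bullet G \<rho> \<eta>) (V_bullet_nonneg G \<rho> \<eta> \<beta>)"

definition P_bullet_K where
  "P_bullet_K G \<rho> \<eta> \<beta> =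
     rational_maps_nonneg projective_morphism (P_bullet G \<rho> \<eta>) (P_bullet_nonneg G \<rho> \<eta> \<beta>)"

definition zero_map where
  "zero_map G \<rho> \<eta> = rat_rel affine_morphism (V_bullet G \<rho> \<eta>) `` {(UNIV, \<lambda>_. 0)}"

text \<open>The map \<open>f \<mapsto> (t \<mapsto> \<complex> f(t))\<close>; the line is defined only where \<open>f\<close> does not vanish.\<close>

definition a_tilde where
  "a_tilde G \<rho> \<eta> F = rat_rel projective_morphism (P_bullet G \<rho> \<eta>) ``
     {({t \<in> U. f t \<noteq> 0}, \<lambda>t. vec.span {f t}) | U f. (U, f) \<in> F}"

section \<open>The semifield and its action\<close>

definition K_semifield :: "real poly fract set" where
  "K_semifield = {Fract [:0, 1:] 1 powi e * Fract f1 f2 | e f1 f2.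
     coeff f1 0 > 0 \<and> coeff f2 0 > 0}"

definition K_mult :: "real poly fract monoid" where
  "K_mult = \<lparr>carrier = K_semifield, mult = (*), one = 1\<rparr>"

definition K_act where
  "K_act G \<rho> \<eta> k F = rat_rel affine_morphism (V_bullet G \<rho> \<eta>) ``
     {({t \<in> U. poly (map_poly of_real q) t \<noteq> 0},
       \<lambda>t. (poly (map_poly of_real p) t / poly (map_poly of_real q) t) *s f t)
      | U f p q. (U, f) \<in> F \<and> q \<noteq> 0 \<and> k = Fract p q}"

end

theory Submission
  imports Defs
begin

text \<open>
  A rational map to \<open>P\<close> lifts to \<open>V\<close> by dividing polynomial homogeneous coordinates by a nonzero
  coordinate in the basis \<open>\<beta>\<close>. Two lifts of the same map differ by a rational function that is
  the ratio of their coordinates at some element of \<open>\<beta>\<close>; it is positive on some \<open>(0, \<epsilon>)\<close>, hence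
  real, hence in \<open>K\<close>.
\<close>

section \<open>Polynomials near zero on the positive real axis\<close>

text \<open>Nonnegativity of a line only provides, for each small \<open>s\<close> separately, some
  nonzero nonnegative vector on it; the scalar relating that vector to the polynomial coordinates
  need not depend on \<open>s\<close> in any regular way. A quotient of two \<beta>-coordinates is
  free of this scalar and still rational in \<open>s\<close>, which makes the lift algebraic. The
  same device compares two lifts, whose pointwise factor is at first an arbitrary function. The
  other difficulty is that maps are classes of partially defined functions, while
  \<open>a_tilde\<close> and \<open>K_act\<close> use all representatives at once. Two nonempty open
  sets meet in a cofinite set, and a cofinite set contains all sufficiently small positive reals, so
  identities and positivity can be checked on one representative after discarding finitely many
  points. The existence of some \<epsilon> is expressed by the filter \<open>at_right 0\<close>, so
  that such conditions can be combined. The orbits of \<open>K\<close> turn out to be the fibres of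
  \<open>a_tilde\<close>, after which the bijection is formal.\<close>

lemma zopen_UNIV: "zopen UNIV"
  by (simp add: zopen_def)

lemma zopen_Int: "zopen U \<Longrightarrow> zopen W \<Longrightarrow> zopen (U \<inter> W)"
  by (simp add: zopen_def Compl_Int)

lemma zopen_mono: "zopen U \<Longrightarrow> U \<subseteq> W \<Longrightarrow> zopen W"
  unfolding zopen_def by (meson Compl_subset_Compl_iff finite_subset)

lemma zopen_nonempty: "zopen U \<Longrightarrow> \<exists>t. t \<in> U"
  unfolding zopen_def using infinite_UNIV_char_0[where 'a=complex] by (metis ComplI UNIV_eq_I)

lemma zopen_poly_nonzero: "p \<noteq> 0 \<Longrightarrow> zopen {t. poly p t \<noteq> 0}"
  by (simp add: zopen_def Collect_neg_eq[symmetric] poly_roots_finite)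

lemma zopen_poly_zero:
  assumes "zopen U" "\<And>t. t \<in> U \<Longrightarrow> poly p t = 0"
  shows "p = 0"
proof (rule ccontr)
  assume "p \<noteq> 0"
  then have "zopen (U \<inter> {t. poly p t \<noteq> 0})"
    using assms(1) zopen_Int zopen_poly_nonzero by blast
  then show False
    using zopen_nonempty assms(2) by blast
qed

lemma zopen_poly_eq:
  assumes "zopen U" "\<And>t. t \<in> U \<Longrightarrow> poly p t = poly q t"
  shows "p = q"
  using zopen_poly_zero[of U "p - q"] assms by simp

text \<open>A finite set of reals does not accumulate at 0, even if it contains 0. This lets
  conditions on open sets be combined with sign conditions near 0.\<close>

lemma zopen_eventually_at_right:
  assumes "zopen U"
  shows "\<forall>\<^sub>F s in at_right 0. complex_of_real s \<in> U"
proof -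
  have "finite {s. complex_of_real s \<in> - U}"
    using assms finite_vimageI[of "- U" complex_of_real]
    by (simp add: zopen_def vimage_def inj_of_real)
  then have "\<not> (0::real) islimpt {s. complex_of_real s \<in> - U}"
    by (rule islimpt_finite)
  then have "\<forall>\<^sub>F s in at 0. complex_of_real s \<in> U"
    by (simp add: islimpt_iff_eventually)
  then show ?thesis
    by (simp add: eventually_at_split)
qed

lemma poly_zero_at_right:
  fixes p :: "complex poly"
  assumes "\<forall>\<^sub>F s in at_right 0. poly p (complex_of_real s) = 0"
  shows "p = 0"
proof (rule ccontr)
  assume "p \<noteq> 0"
  then have "\<forall>\<^sub>F s in at_right 0. poly p (complex_of_real s) \<noteq> 0"
    using zopen_eventually_at_right[OF zopen_poly_nonzero] by simp
  with assms have "\<forall>\<^sub>F s in at_right (0::real). False"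
    by eventually_elim simp
  then show False
    by simp
qed

section \<open>Real polynomials among the complex ones, and signs near 0\<close>

abbreviation cpoly :: "real poly \<Rightarrow> complex poly" where
  "cpoly \<equiv> map_poly of_real"

lemma cpoly_mult: "cpoly (p * q) = cpoly p * cpoly q"
  by (rule poly_eqI) (simp add: coeff_map_poly coeff_mult)

lemma poly_cpoly_of_real: "poly (cpoly p) (of_real s) = of_real (poly p s)"
  by (induction p) (simp_all add: map_poly_pCons)

lemma cpoly_eq_0_iff: "cpoly p = 0 \<longleftrightarrow> p = 0"
  by (simp add: map_poly_eq_0_iff)

text \<open>At real points \<open>map_poly cnj p\<close> takes the conjugate of the value of
  \<open>p\<close>. So the difference of the two vanishes at all small positive reals, hence is
  zero, and every coefficient is real.\<close>

lemma poly_real_at_right: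
  fixes p :: "complex poly"
  assumes "\<forall>\<^sub>F s in at_right 0. poly p (complex_of_real s) \<in> \<real>"
  shows "cpoly (map_poly Re p) = p"
proof -
  have "\<forall>\<^sub>F s in at_right 0. poly (p - map_poly cnj p) (complex_of_real s) = 0"
    using assms by eventually_elim (simp add: Reals_cnj_iff)
  then have "p - map_poly cnj p = 0"
    by (rule poly_zero_at_right)
  then have "coeff (p - map_poly cnj p) i = 0" for i
    by simp
  then have "cnj (coeff p i) = coeff p i" for i
    by (simp add: coeff_map_poly)
  then show ?thesis
    by (intro poly_eqI) (simp add: coeff_map_poly complex_eq_iff)
qed

lemma poly_pos_at_right:
  fixes p :: "real poly"
  assumes "coeff p 0 > 0"
  shows "\<forall>\<^sub>F s in at_right 0. poly p s > 0"
proof -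
  have "(poly p \<longlongrightarrow> poly p 0) (at_right 0)"
    by (intro tendsto_intros)
  then show ?thesis
    using assms by (intro order_tendstoD(1)[of _ "poly p 0"]) (simp_all add: poly_0_coeff_0)
qed

text \<open>Splitting off the full power of the variable leaves \<open>p1\<close> with
  \<open>poly p1 0\<close> nonzero. Since the power is positive at positive points,
  \<open>p1\<close> is nonnegative near 0, and so is its limit \<open>poly p1 0\<close>.\<close>

lemma poly_pos_factor:
  fixes p :: "real poly"
  assumes "\<forall>\<^sub>F s in at_right 0. poly p s > 0"
  obtains m p1 where "p = [:0, 1:] ^ m * p1" "coeff p1 0 > 0"
proof -
  have "p \<noteq> 0"
    using assms by (auto simp: trivial_limit_at_right_real)
  then obtain p1 where p1: "p = [:- 0, 1:] ^ Polynomial.order 0 p * p1" "\<not> [:- 0, 1:] dvd p1"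
    using Polynomial.order_decomp by blast
  have ne: "poly p1 0 \<noteq> 0"
    using p1(2) by (simp add: poly_eq_0_iff_dvd)
  have "\<forall>\<^sub>F s::real in at_right 0. s > 0"
    by (simp add: eventually_at_right_less)
  with assms have "\<forall>\<^sub>F s in at_right 0. poly p1 s \<ge> 0"
  proof eventually_elim
    case (elim s)
    then have "0 < s ^ Polynomial.order 0 p * poly p1 s"
      by (subst (asm) p1(1)) simp
    then show ?case
      using elim(2) by (simp add: zero_less_mult_iff)
  qed
  moreover have "(poly p1 \<longlongrightarrow> poly p1 0) (at_right 0)"
    by (intro tendsto_intros)
  ultimately have "poly p1 0 \<ge> 0"
    by (intro tendsto_lowerbound[OF _ _ trivial_limit_at_right_real])
  with ne p1(1) show thesis
    by (intro that[of "Polynomial.order 0 p" p1]) (simp_all add: poly_0_coeff_0)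
qed

section \<open>The semifield as germs of positive functions\<close>

lemma Fract_power: "Fract a b ^ n = Fract (a ^ n) (b ^ n)" if "b \<noteq> 0"
  using that by (induction n) (simp_all add: One_fract_def)

text \<open>Provides a fraction of the kind that \<open>K_act\<close> evaluates. The power of the
  variable joins the numerator or the denominator according to the sign of \<open>e\<close>.\<close>

lemma K_semifieldD:
  assumes "k \<in> K_semifield"
  obtains p q where "q \<noteq> 0" "k = Fract p q"
    "\<forall>\<^sub>F s in at_right 0. poly p s > 0" "\<forall>\<^sub>F s in at_right 0. poly q s > 0"
proof -
  obtain e f1 f2 where k: "k = Fract [:0, 1:] 1 powi e * Fract f1 f2"
    and pos: "coeff f1 0 > 0" "coeff f2 0 > 0"
    using assms unfolding K_semifield_def by blast
  have ne: "f1 \<noteq> 0" "f2 \<noteq> 0"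
    using pos by auto
  have s: "\<forall>\<^sub>F s::real in at_right 0. s > 0"
    by (simp add: eventually_at_right_less)
  have powpos: "\<forall>\<^sub>F s in at_right 0. poly ([:0, 1:] ^ n * f) s > 0" if "coeff f 0 > 0" for n and f :: "real poly"
    using s poly_pos_at_right[OF that] by eventually_elim simp
  show thesis
  proof (cases "e \<ge> 0")
    case True
    then have "k = Fract ([:0, 1:] ^ nat e * f1) f2"
      using k ne by (simp add: power_int_def Fract_power)
    then show thesis
      using that powpos poly_pos_at_right pos ne by blast
  next
    case False
    then have "k = Fract f1 ([:0, 1:] ^ nat (- e) * f2)"
      using k ne by (simp add: power_int_def Fract_power)
    then show thesis
      using that powpos poly_pos_at_right pos ne by (metis mult_eq_0_iff pCons_eq_0_iff power_not_zero zero_neq_one)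
  qed
qed

text \<open>The exponent is the difference of the orders of vanishing at 0, and the remaining
  cofactors have positive constant terms.\<close>

lemma K_semifieldI:
  assumes "\<forall>\<^sub>F s in at_right 0. poly p s > 0" "\<forall>\<^sub>F s in at_right 0. poly q s > 0"
  shows "Fract p q \<in> K_semifield"
proof -
  obtain m p1 where p: "p = [:0, 1:] ^ m * p1" "coeff p1 0 > 0"
    using poly_pos_factor[OF assms(1)] .
  obtain n q1 where q: "q = [:0, 1:] ^ n * q1" "coeff q1 0 > 0"
    using poly_pos_factor[OF assms(2)] .
  let ?x = "Fract [:0, 1:] 1 :: real poly fract"
  have x: "?x \<noteq> 0"
    by (simp add: Zero_fract_def eq_fract)
  have "Fract p q = ?x ^ m / ?x ^ n * Fract p1 q1"
    using p q by (simp add: Fract_power)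
  also have "?x ^ m / ?x ^ n = ?x powi (int m - int n)"
    using x by (simp add: power_int_diff)
  finally show ?thesis
    unfolding K_semifield_def using p(2) q(2) by blast
qed

text \<open>Multiplying numerator and denominator by the conjugate of the denominator makes both real.\<close>

lemma positive_ratio_in_K:
  fixes a d :: "complex poly"
  assumes "d \<noteq> 0"
    and pos: "\<forall>\<^sub>F s in at_right 0. \<exists>x>0. poly a (of_real s) = of_real x * poly d (of_real s)"
  obtains p q where "q \<noteq> 0" "Fract p q \<in> K_semifield" "cpoly p * d = cpoly q * a"
proof -
  \<comment> \<open>Conjugating coefficients keeps \<open>dc\<close> a polynomial; its values are
    the conjugates of those of \<open>d\<close> on the real axis. There \<open>d * dc\<close> is the
    squared modulus of \<open>d\<close>, and \<open>a * dc\<close> is a positive multiple of it near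
    0.\<close>
  define dc where "dc = map_poly cnj d"
  have dc0: "dc \<noteq> 0"
    using assms(1) by (simp add: dc_def map_poly_eq_0_iff)
  have dcs: "poly dc (of_real s) = cnj (poly d (of_real s))" for s
    by (simp add: dc_def)
  have nz: "\<forall>\<^sub>F s in at_right 0. poly d (complex_of_real s) \<noteq> 0"
    using zopen_eventually_at_right[OF zopen_poly_nonzero[OF assms(1)]] by simp
  define p q where "p = map_poly Re (a * dc)" and "q = map_poly Re (d * dc)"
  have dd: "poly (d * dc) (of_real s) = of_real ((cmod (poly d (of_real s)))\<^sup>2)" for s
    by (simp add: dcs complex_norm_square del: of_real_power)
  have ad: "poly (a * dc) (of_real s) = of_real (x * (cmod (poly d (of_real s)))\<^sup>2)"
    if "poly a (of_real s) = of_real x * poly d (of_real s)" for s x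
    using that dd[of s] by (simp add: mult.assoc)
  have q: "cpoly q = d * dc"
    unfolding q_def by (rule poly_real_at_right) (simp only: dd Reals_of_real eventually_True)
  have p: "cpoly p = a * dc"
    unfolding p_def
    by (rule poly_real_at_right, rule eventually_mono[OF pos]) (use ad in \<open>metis Reals_of_real\<close>)
  have "\<forall>\<^sub>F s in at_right 0. poly q s > 0"
    using nz
  proof eventually_elim
    case (elim s)
    have "complex_of_real (poly q s) = of_real ((cmod (poly d (of_real s)))\<^sup>2)"
      using dd[of s] q by (simp add: poly_cpoly_of_real[symmetric])
    then show ?case
      using elim by (metis of_real_eq_iff zero_less_norm_iff zero_less_power)
  qed
  moreover have "\<forall>\<^sub>F s in at_right 0. poly p s > 0"
    using nz pos
  proof eventually_elim
    case (elim s)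
    then obtain x where x: "x > 0" "poly a (of_real s) = of_real x * poly d (of_real s)"
      by blast
    have "complex_of_real (poly p s) = of_real (x * (cmod (poly d (of_real s)))\<^sup>2)"
      using ad[OF x(2)] p by (simp add: poly_cpoly_of_real[symmetric])
    then have "poly p s = x * (cmod (poly d (of_real s)))\<^sup>2"
      by (simp only: of_real_eq_iff)
    then show ?case
      using elim(1) x(1) by simp
  qed
  ultimately have K: "Fract p q \<in> K_semifield"
    by (rule K_semifieldI[rotated])
  have "d * dc \<noteq> 0"
    using assms(1) dc0 by simp
  then have "q \<noteq> 0"
    using q by (metis map_poly_0)
  moreover have "cpoly p * d = cpoly q * a"
    unfolding p q by (simp only: mult_ac)
  ultimately show thesis
    using K by (intro that)
qed

section \<open>Rational maps as germs on cofinite sets\<close>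

text \<open>Morphisms that agree on a dense open set agree wherever both are defined; this makes
  \<open>rat_rel\<close> transitive.\<close>

definition separated_mor :: "(complex set \<Rightarrow> (complex \<Rightarrow> 'x) \<Rightarrow> bool) \<Rightarrow> bool" where
  "separated_mor mor \<longleftrightarrow> (\<forall>U f U' f' W. zopen U \<longrightarrow> zopen U' \<longrightarrow> zopen W \<longrightarrow> mor U f \<longrightarrow> mor U' f' \<longrightarrow>
     (\<forall>t\<in>U \<inter> U' \<inter> W. f t = f' t) \<longrightarrow> (\<forall>t\<in>U \<inter> U'. f t = f' t))"

text \<open>Agreement only has to be checked on a cofinite set \<open>W\<close>, which can be chosen
  to avoid zeros of denominators; separatedness extends it to the common domain.\<close>

lemma rat_relI:
  assumes "separated_mor mor" "(U, f) \<in> rat_reps mor X" "(U', f') \<in> rat_reps mor X"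
    and "zopen W" "\<And>t. t \<in> U \<Longrightarrow> t \<in> U' \<Longrightarrow> t \<in> W \<Longrightarrow> f t = f' t"
  shows "((U, f), (U', f')) \<in> rat_rel mor X"
  using assms unfolding separated_mor_def rat_rel_def rat_reps_def by blast

lemma equiv_rat_rel:
  assumes "separated_mor mor"
  shows "equiv (rat_reps mor X) (rat_rel mor X)"
proof (rule equivI)
  show "rat_rel mor X \<subseteq> rat_reps mor X \<times> rat_reps mor X"
    by (auto simp: rat_rel_def)
  show "refl_on (rat_reps mor X) (rat_rel mor X)"
    by (auto simp: rat_rel_def refl_on_def)
  show "sym (rat_rel mor X)"
    unfolding rat_rel_def sym_def by fastforce
  show "trans (rat_rel mor X)"
  proof (rule transI, clarify)
    fix U f U' f' U'' f''
    assume r: "((U, f), (U', f')) \<in> rat_rel mor X" "((U', f'), (U'', f'')) \<in> rat_rel mor X"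
    then have "zopen U'" "(U, f) \<in> rat_reps mor X" "(U'', f'') \<in> rat_reps mor X"
      by (auto simp: rat_rel_def rat_reps_def)
    \<comment> \<open>The middle map compares \<open>f\<close> with \<open>f''\<close> only inside
      its own domain, hence the choice of \<open>W\<close>.\<close>
    then show "((U, f), (U'', f'')) \<in> rat_rel mor X"
      using r by (intro rat_relI[OF assms, where W = U']) (auto simp: rat_rel_def)
  qed
qed

text \<open>\<open>a_tilde\<close> and \<open>K_act\<close> are images of sets built from all
  representatives of a class. Once every member of such a set is related to a single pair, the image
  collapses to one class; this gives well-definedness.\<close>

lemma Image_const_class:
  assumes "equiv A r" "S \<noteq> {}" "\<And>s. s \<in> S \<Longrightarrow> (a, s) \<in> r"
  shows "r `` S = r `` {a}"
proof -
  have "r `` {s} = r `` {a}" if "s \<in> S" for s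
    using equiv_class_eq[OF assms(1) assms(3)[OF that]] by simp
  then show ?thesis
    using assms(2) by blast
qed

text \<open>The definition asks for one suitable representative; here any given one can be tested,
  because two representatives agree on the intersection of their domains, which contains all small
  positive reals.\<close>

lemma rational_maps_nonneg_iff:
  assumes "separated_mor mor" "(U, f) \<in> rat_reps mor X"
  shows "rat_rel mor X `` {(U, f)} \<in> rational_maps_nonneg mor X Xnn \<longleftrightarrow>
    (\<forall>\<^sub>F s in at_right 0. f (of_real s) \<in> Xnn)"
proof
  note eq = equiv_rat_rel[OF assms(1), of X]
  have zU: "zopen U"
    using assms(2) by (simp add: rat_reps_def)
  { assume "rat_rel mor X `` {(U, f)} \<in> rational_maps_nonneg mor X Xnn"
    then obtain U' f' \<epsilon> where *: "((U, f), (U', f')) \<in> rat_rel mor X" "\<epsilon> > 0"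
      "\<And>s::real. 0 < s \<Longrightarrow> s < \<epsilon> \<Longrightarrow> of_real s \<in> U' \<and> f' (of_real s) \<in> Xnn"
      unfolding rational_maps_nonneg_def by auto
    then have "\<forall>\<^sub>F s in at_right 0. of_real s \<in> U' \<and> f' (of_real s) \<in> Xnn"
      by (auto simp: eventually_at_right_field)
    with zopen_eventually_at_right[OF zU]
    show "\<forall>\<^sub>F s in at_right 0. f (of_real s) \<in> Xnn"
      by eventually_elim (use *(1) in \<open>auto simp: rat_rel_def\<close>) }
  { assume "\<forall>\<^sub>F s in at_right 0. f (of_real s) \<in> Xnn"
    with zopen_eventually_at_right[OF zU]
    have "\<forall>\<^sub>F s in at_right 0. of_real s \<in> U \<and> f (of_real s) \<in> Xnn"
      by eventually_elim simp
    then obtain \<epsilon> where "\<epsilon> > 0" "\<And>s::real. 0 < s \<Longrightarrow> s < \<epsilon> \<Longrightarrow> of_real s \<in> U \<and> f (of_real s) \<in> Xnn"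
      by (auto simp: eventually_at_right_field)
    moreover have "(U, f) \<in> rat_rel mor X `` {(U, f)}"
      using assms(2) eq by (rule equiv_class_self[rotated])
    moreover have "rat_rel mor X `` {(U, f)} \<in> rational_maps mor X"
      using assms(2) by (simp add: rational_maps_def quotientI)
    ultimately show "rat_rel mor X `` {(U, f)} \<in> rational_maps_nonneg mor X Xnn"
      unfolding rational_maps_nonneg_def by blast }
qed

lemma rational_maps_nonnegE:
  assumes "separated_mor mor" "F \<in> rational_maps_nonneg mor X Xnn"
  obtains U f where "F = rat_rel mor X `` {(U, f)}" "(U, f) \<in> rat_reps mor X" "zopen U" "mor U f"
    "\<And>t. t \<in> U \<Longrightarrow> f t \<in> X" "\<forall>\<^sub>F s in at_right 0. f (of_real s) \<in> Xnn"
proof -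
  have "F \<in> rat_reps mor X // rat_rel mor X"
    using assms(2) by (simp add: rational_maps_nonneg_def rational_maps_def)
  then obtain U f where F: "F = rat_rel mor X `` {(U, f)}" "(U, f) \<in> rat_reps mor X"
    by (auto elim!: quotientE)
  with assms have "\<forall>\<^sub>F s in at_right 0. f (of_real s) \<in> Xnn"
    using rational_maps_nonneg_iff by blast
  moreover have "zopen U" "mor U f" "\<And>t. t \<in> U \<Longrightarrow> f t \<in> X"
    using F(2) by (auto simp: rat_reps_def)
  ultimately show thesis
    using that F by blast
qed

section \<open>Affine and projective morphisms in polynomial coordinates\<close>

definition polyvec :: "('d \<Rightarrow> complex poly) \<Rightarrow> complex \<Rightarrow> complex^'d::finite" where
  "polyvec p t = (\<chi> j. poly (p j) t)"

lemma zopen_polyvec_nonzero: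
  assumes "polyvec p t0 \<noteq> 0"
  shows "zopen {t. polyvec p t \<noteq> 0}"
proof -
  obtain j where "poly (p j) t0 \<noteq> 0"
    using assms by (auto simp: polyvec_def vec_eq_iff)
  then have "p j \<noteq> 0"
    by auto
  then show ?thesis
    by (rule zopen_mono[OF zopen_poly_nonzero]) (auto simp: polyvec_def vec_eq_iff)
qed

text \<open>The separate denominators of the coordinates are replaced by their product; where it is
  nonzero, all the coordinate formulas are valid at once.\<close>

lemma affine_morphism_local:
  fixes f :: "complex \<Rightarrow> complex^'d"
  assumes "affine_morphism U f" "t0 \<in> U"
  obtains p q where "poly q t0 \<noteq> 0"
    "\<And>t. t \<in> U \<Longrightarrow> poly q t \<noteq> 0 \<Longrightarrow> f t = inverse (poly q t) *s polyvec p t"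
proof -
  have "\<forall>j. \<exists>p q. poly q t0 \<noteq> 0 \<and> (\<forall>t\<in>U. poly q t \<noteq> 0 \<longrightarrow> f t $ j = poly p t / poly q t)"
    using assms unfolding affine_morphism_def regular_function_def by blast
  then have "\<exists>p q. \<forall>j. poly (q j) t0 \<noteq> 0 \<and> (\<forall>t\<in>U. poly (q j) t \<noteq> 0 \<longrightarrow> f t $ j = poly (p j) t / poly (q j) t)"
    by (simp only: choice_iff)
  then obtain p q where pq: "\<And>j. poly (q j) t0 \<noteq> 0"
    "\<And>j t. t \<in> U \<Longrightarrow> poly (q j) t \<noteq> 0 \<Longrightarrow> f t $ j = poly (p j) t / poly (q j) t"
    by blast
  define Q where "Q = prod q UNIV"
  define P where "P j = p j * prod q (UNIV - {j})" for j
  have Q: "poly Q t = poly (q j) t * poly (prod q (UNIV - {j})) t" for j t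
    by (simp add: Q_def prod.remove[of UNIV j])
  show thesis
  proof (rule that[of Q P])
    show "poly Q t0 \<noteq> 0"
      using pq(1) by (simp add: Q_def poly_prod)
    fix t assume t: "t \<in> U" "poly Q t \<noteq> 0"
    have "f t $ j = poly (P j) t / poly Q t" for j
      using t Q[of t j] pq(2)[OF t(1), of j] by (auto simp: P_def)
    then show "f t = inverse (poly Q t) *s polyvec P t"
      by (simp add: vec_eq_iff polyvec_def divide_inverse mult.commute)
  qed
qed

lemma affine_morphismI:
  assumes "\<And>t0. t0 \<in> U \<Longrightarrow> \<exists>p q. poly q t0 \<noteq> 0 \<and>
    (\<forall>t\<in>U. poly q t \<noteq> 0 \<longrightarrow> f t = inverse (poly q t) *s polyvec p t)"
  shows "affine_morphism U f"
  unfolding affine_morphism_def regular_function_def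
proof (intro allI ballI)
  fix j t0 assume "t0 \<in> U"
  then obtain p q where "poly q t0 \<noteq> 0"
    "\<forall>t\<in>U. poly q t \<noteq> 0 \<longrightarrow> f t = inverse (poly q t) *s polyvec p t"
    using assms by blast
  then show "\<exists>p q. poly q t0 \<noteq> 0 \<and> (\<forall>t\<in>U. poly q t \<noteq> 0 \<longrightarrow> f t $ j = poly p t / poly q t)"
    by (intro exI[of _ "p j"] exI[of _ q]) (simp add: polyvec_def divide_inverse mult.commute)
qed

text \<open>After cross-multiplication, agreement on a cofinite set becomes an identity of
  polynomials. It can be evaluated at \<open>t0\<close>, where both local denominators are
  nonzero.\<close>

lemma separated_affine: "separated_mor affine_morphism"
  unfolding separated_mor_def
proof (intro allI impI ballI)
  fix U U' W :: "complex set" and f f' :: "complex \<Rightarrow> complex^'d" and t0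
  assume z: "zopen U" "zopen U'" "zopen W" and m: "affine_morphism U f" "affine_morphism U' f'"
    and eq: "\<forall>t\<in>U \<inter> U' \<inter> W. f t = f' t" and t: "t0 \<in> U \<inter> U'"
  then have t0: "t0 \<in> U" "t0 \<in> U'"
    by auto
  obtain p q where pq: "poly q t0 \<noteq> 0"
    "\<And>t. t \<in> U \<Longrightarrow> poly q t \<noteq> 0 \<Longrightarrow> f t = inverse (poly q t) *s polyvec p t"
    by (rule affine_morphism_local[OF m(1) t0(1)]) blast
  obtain p' q' where pq': "poly q' t0 \<noteq> 0"
    "\<And>t. t \<in> U' \<Longrightarrow> poly q' t \<noteq> 0 \<Longrightarrow> f' t = inverse (poly q' t) *s polyvec p' t"
    by (rule affine_morphism_local[OF m(2) t0(2)]) blast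
  have q0: "q \<noteq> 0" "q' \<noteq> 0"
    using pq(1) pq'(1) by auto
  let ?W = "U \<inter> U' \<inter> W \<inter> {t. poly q t \<noteq> 0} \<inter> {t. poly q' t \<noteq> 0}"
  have zW: "zopen ?W"
    using z q0 by (intro zopen_Int zopen_poly_nonzero)
  have "p j * q' = p' j * q" for j
  proof (rule zopen_poly_eq[OF zW])
    fix t assume t: "t \<in> ?W"
    then have "f t = f' t"
      using eq by blast
    then have "inverse (poly q t) *s polyvec p t = inverse (poly q' t) *s polyvec p' t"
      using t pq(2)[of t] pq'(2)[of t] by simp
    then have "inverse (poly q t) * poly (p j) t = inverse (poly q' t) * poly (p' j) t"
      by (simp add: vec_eq_iff polyvec_def)
    then show "poly (p j * q') t = poly (p' j * q) t"
      using t by (simp add: field_simps)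
  qed
  then have "poly (p j) t0 * poly q' t0 = poly (p' j) t0 * poly q t0" for j
    by (metis poly_mult)
  then have "inverse (poly q t0) *s polyvec p t0 = inverse (poly q' t0) *s polyvec p' t0"
    using pq(1) pq'(1) by (simp add: vec_eq_iff polyvec_def field_simps)
  then show "f t0 = f' t0"
    using pq(2)[OF t0(1) pq(1)] pq'(2)[OF t0(2) pq'(1)] by simp
qed

lemma projective_morphism_local:
  fixes f :: "complex \<Rightarrow> (complex^'d) set"
  assumes "projective_morphism U f" "t0 \<in> U"
  obtains p where "polyvec p t0 \<noteq> 0"
    "\<And>t. t \<in> U \<Longrightarrow> polyvec p t \<noteq> 0 \<Longrightarrow> f t = vec.span {polyvec p t}"
  using assms unfolding projective_morphism_def polyvec_def by metis

lemma vec_span_singleton: "vec.span {v} = range (\<lambda>c. c *s v)" for v :: "complex^'d"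
  by (rule vec.span_singleton)

lemma span_singleton_eqE:
  fixes u v :: "complex^'d"
  assumes "vec.span {u} = vec.span {v}" "u \<noteq> 0"
  obtains c where "c \<noteq> 0" "u = c *s v"
proof -
  have "u \<in> vec.span {v}"
    using assms(1) vec.span_base[of u "{u}"] by auto
  then obtain c where "u = c *s v"
    by (auto simp: vec_span_singleton)
  with assms(2) that show thesis
    by (metis vec.scale_zero_left)
qed

lemma span_singleton_scale:
  fixes v :: "complex^'d"
  assumes "c \<noteq> 0"
  shows "vec.span {c *s v} = vec.span {v}"
  unfolding vec_span_singleton
proof (intro subset_antisym image_subsetI)
  fix d :: complex
  show "d *s (c *s v) \<in> range (\<lambda>d. d *s v)"
    by (rule range_eqI[of _ _ "d * c"]) simp
  show "d *s v \<in> range (\<lambda>d. d *s (c *s v))"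
    using assms by (intro range_eqI[of _ _ "d / c"]) simp
qed

text \<open>Proportionality of two coordinate vectors forces their 2 by 2 minors to vanish. The
  minors are polynomials in \<open>t\<close>, so they vanish at \<open>t0\<close> as well, where
  both vectors are nonzero and therefore span the same line.\<close>

lemma separated_projective: "separated_mor projective_morphism"
  unfolding separated_mor_def
proof (intro allI impI ballI)
  fix U U' W :: "complex set" and f f' :: "complex \<Rightarrow> (complex^'d) set" and t0
  assume z: "zopen U" "zopen U'" "zopen W" and m: "projective_morphism U f" "projective_morphism U' f'"
    and eq: "\<forall>t\<in>U \<inter> U' \<inter> W. f t = f' t" and t: "t0 \<in> U \<inter> U'"
  then have t0: "t0 \<in> U" "t0 \<in> U'"
    by auto
  obtain p where p: "polyvec p t0 \<noteq> 0"
    "\<And>t. t \<in> U \<Longrightarrow> polyvec p t \<noteq> 0 \<Longrightarrow> f t = vec.span {polyvec p t}"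
    by (rule projective_morphism_local[OF m(1) t0(1)]) blast
  obtain p' where p': "polyvec p' t0 \<noteq> 0"
    "\<And>t. t \<in> U' \<Longrightarrow> polyvec p' t \<noteq> 0 \<Longrightarrow> f' t = vec.span {polyvec p' t}"
    by (rule projective_morphism_local[OF m(2) t0(2)]) blast
  let ?W = "U \<inter> U' \<inter> W \<inter> {t. polyvec p t \<noteq> 0} \<inter> {t. polyvec p' t \<noteq> 0}"
  have zW: "zopen ?W"
    using z p(1) p'(1) by (intro zopen_Int zopen_polyvec_nonzero)
  have minors: "p i * p' j = p j * p' i" for i j
  proof (rule zopen_poly_eq[OF zW])
    fix t assume t: "t \<in> ?W"
    then have "f t = f' t"
      using eq by blast
    then have "vec.span {polyvec p t} = vec.span {polyvec p' t}"
      using t p(2)[of t] p'(2)[of t] by simp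
    then obtain c where "polyvec p t = c *s polyvec p' t"
      using span_singleton_eqE t by blast
    then have "poly (p i) t = c * poly (p' i) t" "poly (p j) t = c * poly (p' j) t"
      by (simp_all add: polyvec_def vec_eq_iff)
    then show "poly (p i * p' j) t = poly (p j * p' i) t"
      by simp
  qed
  \<comment> \<open>The factor between the two vectors is read off at a coordinate where the second
    one is nonzero.\<close>
  obtain j where j: "poly (p' j) t0 \<noteq> 0"
    using p'(1) by (auto simp: polyvec_def vec_eq_iff)
  have par: "poly (p i) t0 = poly (p j) t0 / poly (p' j) t0 * poly (p' i) t0" for i
  proof -
    have "poly (p i) t0 * poly (p' j) t0 = poly (p j) t0 * poly (p' i) t0"
      unfolding poly_mult[symmetric] minors[of i j] ..
    then show ?thesis
      by (simp only: times_divide_eq_left nonzero_eq_divide_eq[OF j])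
  qed
  let ?c = "poly (p j) t0 / poly (p' j) t0"
  have eqv: "polyvec p t0 = ?c *s polyvec p' t0"
    unfolding vec_eq_iff by (simp only: polyvec_def vec_lambda_beta vector_smult_component par[symmetric] simp_thms)
  moreover have "?c \<noteq> 0"
    using eqv p(1) by auto
  ultimately have "vec.span {polyvec p t0} = vec.span {polyvec p' t0}"
    by (metis span_singleton_scale)
  then show "f t0 = f' t0"
    using p(2)[OF t0(1) p(1)] p'(2)[OF t0(2) p'(1)] by simp
qed

section \<open>Cones over families of lines\<close>

lemma V_nonneg_scale:
  assumes "vec.independent \<beta>" "vec.span \<beta> = UNIV" "u \<in> V_nonneg \<beta>" "c \<in> \<real>\<^sub>\<ge>\<^sub>0"
  shows "c *s u \<in> V_nonneg \<beta>"
  using assms by (auto simp: V_nonneg_def vec.representation_scale intro: nonneg_Reals_mult_I)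

text \<open>A \<beta>-coordinate is a fixed linear functional, so it is a constant combination of
  the \<open>p j\<close>. This links the standard coordinates, in which morphisms are defined, to
  those in which positivity is defined.\<close>

lemma representation_polyvec:
  assumes "vec.independent \<beta>" "vec.span \<beta> = UNIV"
  obtains c where "\<And>t. vec.representation \<beta> (polyvec p t) b = poly c t"
proof (rule that)
  fix t
  have "polyvec p t = (\<Sum>j\<in>UNIV. poly (p j) t *s axis j 1)"
    using basis_expansion[of "polyvec p t"] by (simp add: polyvec_def)
  then have "vec.representation \<beta> (polyvec p t) b
      = (\<Sum>j\<in>UNIV. poly (p j) t * vec.representation \<beta> (axis j 1) b)"
    using assms by (simp add: vec.representation_sum vec.representation_scale)
  also have "\<dots> = poly (\<Sum>j\<in>UNIV. smult (vec.representation \<beta> (axis j 1) b) (p j)) t"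
    by (simp add: poly_sum mult.commute)
  finally show "vec.representation \<beta> (polyvec p t) b
    = poly (\<Sum>j\<in>UNIV. smult (vec.representation \<beta> (axis j 1) b) (p j)) t" .
qed

lemma representation_nonzeroE:
  assumes "vec.independent \<beta>" "vec.span \<beta> = UNIV" "u \<noteq> 0"
  obtains b where "b \<in> \<beta>" "vec.representation \<beta> u b \<noteq> 0"
proof -
  have "(\<Sum>b | vec.representation \<beta> u b \<noteq> 0. vec.representation \<beta> u b *s b) = u"
    using assms vec.sum_nonzero_representation_eq by blast
  then have "{b. vec.representation \<beta> u b \<noteq> 0} \<noteq> {}"
    using assms(3) by (metis sum.empty)
  then show thesis
    using that vec.representation_ne_zero by blast
qed

text \<open>The setting of the lifting argument: \<open>P\<close> is a family of lines and
  \<open>V\<close> is their union. Nonemptiness puts 0 into \<open>V\<close>, so that the zero map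
  is a genuine element of the set of rational maps.\<close>

locale line_family =
  fixes G :: "(complex^'n^'n) set" and \<rho> :: "complex^'n^'n \<Rightarrow> complex^'d^'d"
    and \<eta> :: "complex^'d" and \<beta> :: "(complex^'d) set"
  assumes lines: "L \<in> P_bullet G \<rho> \<eta> \<Longrightarrow> \<exists>v. v \<noteq> 0 \<and> L = vec.span {v}"
    and nonempty: "P_bullet G \<rho> \<eta> \<noteq> {}"
    and independent: "vec.independent \<beta>" and spanning: "vec.span \<beta> = UNIV"
begin

abbreviation "V \<equiv> V_bullet G \<rho> \<eta>"
abbreviation "P \<equiv> P_bullet G \<rho> \<eta>"
abbreviation "V_class U f \<equiv> rat_rel affine_morphism V `` {(U, f)}"
abbreviation "P_class U f \<equiv> rat_rel projective_morphism P `` {(U, f)}"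
abbreviation "V_maps \<equiv> V_bullet_K G \<rho> \<eta> \<beta> - {zero_map G \<rho> \<eta>}"

lemmas equiv_V = equiv_rat_rel[OF separated_affine, of V]
lemmas equiv_P = equiv_rat_rel[OF separated_projective, of P]
lemmas representation_scale = vec.representation_scale[OF independent, unfolded spanning, OF UNIV_I]

lemma V_memI: "L \<in> P \<Longrightarrow> v \<in> L \<Longrightarrow> v \<in> V"
  by (auto simp: V_bullet_def)

lemma span_in_P:
  assumes "v \<in> V" "v \<noteq> 0"
  shows "vec.span {v} \<in> P"
proof -
  obtain L where L: "L \<in> P" "v \<in> L"
    using assms(1) by (auto simp: V_bullet_def)
  then obtain w c where w: "L = vec.span {w}" "v = c *s w"
    using lines by (metis rangeE vec_span_singleton)
  then have "c \<noteq> 0"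
    using assms(2) by auto
  then show ?thesis
    using L(1) w span_singleton_scale by metis
qed

lemma scale_in_V: "v \<in> V \<Longrightarrow> c *s v \<in> V"
  unfolding V_bullet_def using lines vec.span_scale by (metis UnionE UnionI)

lemma zero_in_V: "0 \<in> V"
proof -
  obtain L where "L \<in> P"
    using nonempty by blast
  moreover from this have "0 \<in> L"
    using lines vec.span_zero by metis
  ultimately show ?thesis
    by (rule V_memI)
qed

section \<open>\<open>a_tilde\<close> and \<open>K_act\<close> computed on a representative\<close>

lemma V_repsD:
  assumes "(U, f) \<in> rat_reps affine_morphism V"
  shows "zopen U" "affine_morphism U f" "t \<in> U \<Longrightarrow> f t \<in> V"
  using assms by (auto simp: rat_reps_def)

lemma V_relD:
  assumes "((U, f), (U', f')) \<in> rat_rel affine_morphism V"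
  shows "(U', f') \<in> rat_reps affine_morphism V" "t \<in> U \<Longrightarrow> t \<in> U' \<Longrightarrow> f t = f' t"
  using assms by (auto simp: rat_rel_def)

text \<open>A single nonzero value makes the local numerator vector nonzero as a tuple of
  polynomials, hence nonzero at almost all points. The witness \<open>t1\<close> is the working form
  of not being the zero map.\<close>

lemma zopen_support:
  assumes f: "(U, f) \<in> rat_reps affine_morphism V" "t1 \<in> U" "f t1 \<noteq> 0"
  shows "zopen {t \<in> U. f t \<noteq> 0}"
proof -
  obtain p q where pq: "poly q t1 \<noteq> 0"
    "\<And>t. t \<in> U \<Longrightarrow> poly q t \<noteq> 0 \<Longrightarrow> f t = inverse (poly q t) *s polyvec p t"
    by (rule affine_morphism_local[OF V_repsD(2)[OF f(1)] f(2)]) blast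
  have "polyvec p t1 \<noteq> 0"
    using pq(2)[OF f(2) pq(1)] f(3) by auto
  moreover have "q \<noteq> 0"
    using pq(1) by auto
  ultimately have "zopen (U \<inter> {t. polyvec p t \<noteq> 0} \<inter> {t. poly q t \<noteq> 0})"
    using V_repsD(1)[OF f(1)] by (intro zopen_Int zopen_polyvec_nonzero zopen_poly_nonzero)
  then show ?thesis
    by (rule zopen_mono) (auto simp: pq(2))
qed

lemma span_reps:
  assumes f: "(U, f) \<in> rat_reps affine_morphism V" "t1 \<in> U" "f t1 \<noteq> 0"
  shows "({t \<in> U. f t \<noteq> 0}, \<lambda>t. vec.span {f t}) \<in> rat_reps projective_morphism P"
proof -
  have "projective_morphism {t \<in> U. f t \<noteq> 0} (\<lambda>t. vec.span {f t})"
    unfolding projective_morphism_def polyvec_def[symmetric]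
  proof
    fix t0 assume "t0 \<in> {t \<in> U. f t \<noteq> 0}"
    then have t0: "t0 \<in> U" "f t0 \<noteq> 0"
      by auto
    obtain p q where pq: "poly q t0 \<noteq> 0"
      "\<And>t. t \<in> U \<Longrightarrow> poly q t \<noteq> 0 \<Longrightarrow> f t = inverse (poly q t) *s polyvec p t"
      by (rule affine_morphism_local[OF V_repsD(2)[OF f(1)] t0(1)]) blast
    \<comment> \<open>the extra factor \<open>q\<close> makes the homogeneous coordinates vanish where \<open>p / q\<close> does not represent \<open>f\<close>\<close>
    have qp: "polyvec (\<lambda>j. q * p j) t = poly q t *s polyvec p t" for t
      by (simp add: polyvec_def vec_eq_iff)
    have "polyvec (\<lambda>j. q * p j) t0 \<noteq> 0"
      using pq(2)[OF t0(1) pq(1)] t0(2) pq(1) by (auto simp: qp)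
    moreover have "vec.span {f t} = vec.span {polyvec (\<lambda>j. q * p j) t}"
      if "t \<in> U" "polyvec (\<lambda>j. q * p j) t \<noteq> 0" for t
    proof -
      have "poly q t \<noteq> 0"
        using that(2) by (auto simp: qp)
      then show ?thesis
        using pq(2)[OF that(1)] by (simp add: qp span_singleton_scale)
    qed
    ultimately show "\<exists>p. polyvec p t0 \<noteq> 0 \<and> (\<forall>t\<in>{t \<in> U. f t \<noteq> 0}. polyvec p t \<noteq> 0 \<longrightarrow>
        vec.span {f t} = vec.span {polyvec p t})"
      by blast
  qed
  then show ?thesis
    using zopen_support[OF f] span_in_P V_repsD(3)[OF f(1)] by (simp add: rat_reps_def)
qed

lemma a_tilde_class:
  assumes f: "(U, f) \<in> rat_reps affine_morphism V" "t1 \<in> U" "f t1 \<noteq> 0"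
  shows "a_tilde G \<rho> \<eta> (V_class U f) = P_class {t \<in> U. f t \<noteq> 0} (\<lambda>t. vec.span {f t})"
  unfolding a_tilde_def
proof (rule Image_const_class[OF equiv_P])
  have "(U, f) \<in> V_class U f"
    using equiv_class_self[OF equiv_V f(1)] .
  then show "{({t \<in> U'. f' t \<noteq> 0}, \<lambda>t. vec.span {f' t}) |U' f'. (U', f') \<in> V_class U f} \<noteq> {}"
    by blast
  fix s assume "s \<in> {({t \<in> U'. f' t \<noteq> 0}, \<lambda>t. vec.span {f' t}) |U' f'. (U', f') \<in> V_class U f}"
  then obtain U' f' where s: "s = ({t \<in> U'. f' t \<noteq> 0}, \<lambda>t. vec.span {f' t})"
    and rel: "((U, f), (U', f')) \<in> rat_rel affine_morphism V"
    by blast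
  \<comment> \<open>The two domains share a point where \<open>f\<close> is nonzero, so the other
    representative is not identically zero and \<open>span_reps\<close> applies to it.\<close>
  have "zopen ({t \<in> U. f t \<noteq> 0} \<inter> U')"
    using zopen_Int[OF zopen_support[OF f] V_repsD(1)[OF V_relD(1)[OF rel]]] .
  then obtain t2 where t2: "t2 \<in> U" "f t2 \<noteq> 0" "t2 \<in> U'"
    using zopen_nonempty by blast
  then have "f' t2 \<noteq> 0"
    using V_relD(2)[OF rel] by metis
  then have "s \<in> rat_reps projective_morphism P"
    using span_reps[OF V_relD(1)[OF rel] t2(3)] s by simp
  then show "(({t \<in> U. f t \<noteq> 0}, \<lambda>t. vec.span {f t}), s) \<in> rat_rel projective_morphism P"
    unfolding s
    by (rule rat_relI[OF separated_projective span_reps[OF f] _ zopen_UNIV])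
      (use V_relD(2)[OF rel] in auto)
qed

lemma scale_reps:
  fixes p q :: "complex poly"
  assumes f: "(U, f) \<in> rat_reps affine_morphism V" and "q \<noteq> 0"
  shows "({t \<in> U. poly q t \<noteq> 0}, \<lambda>t. (poly p t / poly q t) *s f t) \<in> rat_reps affine_morphism V"
proof -
  have "zopen (U \<inter> {t. poly q t \<noteq> 0})"
    using zopen_Int[OF V_repsD(1)[OF f] zopen_poly_nonzero[OF assms(2)]] .
  moreover have "affine_morphism {t \<in> U. poly q t \<noteq> 0} (\<lambda>t. (poly p t / poly q t) *s f t)"
  proof (rule affine_morphismI)
    fix t0 assume "t0 \<in> {t \<in> U. poly q t \<noteq> 0}"
    then have t0: "t0 \<in> U" "poly q t0 \<noteq> 0"
      by auto
    obtain a b where ab: "poly b t0 \<noteq> 0"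
      "\<And>t. t \<in> U \<Longrightarrow> poly b t \<noteq> 0 \<Longrightarrow> f t = inverse (poly b t) *s polyvec a t"
      by (rule affine_morphism_local[OF V_repsD(2)[OF f] t0(1)]) blast
    have "poly (q * b) t0 \<noteq> 0"
      using t0 ab by simp
    moreover have "(poly p t / poly q t) *s f t
        = inverse (poly (q * b) t) *s polyvec (\<lambda>j. p * a j) t"
      if "t \<in> {t \<in> U. poly q t \<noteq> 0}" "poly (q * b) t \<noteq> 0" for t
      using that ab(2)[of t] by (simp add: polyvec_def vec_eq_iff divide_inverse)
    ultimately show "\<exists>a b. poly b t0 \<noteq> 0 \<and> (\<forall>t\<in>{t \<in> U. poly q t \<noteq> 0}. poly b t \<noteq> 0 \<longrightarrow>
        (poly p t / poly q t) *s f t = inverse (poly b t) *s polyvec a t)"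
      by blast
  qed
  ultimately show ?thesis
    using scale_in_V V_repsD(3)[OF f] by (simp add: rat_reps_def Collect_conj_eq)
qed

text \<open>Two choices have to be reconciled: the representative of the map and the fraction for
  the scalar. Equal fractions satisfy a cross-multiplied identity of real polynomials, which
  \<open>cpoly\<close> transports to complex points.\<close>

lemma K_act_class:
  assumes f: "(U, f) \<in> rat_reps affine_morphism V" and q: "q \<noteq> 0"
  shows "K_act G \<rho> \<eta> (Fract p q) (V_class U f) =
    V_class {t \<in> U. poly (cpoly q) t \<noteq> 0} (\<lambda>t. (poly (cpoly p) t / poly (cpoly q) t) *s f t)"
  unfolding K_act_def
proof (rule Image_const_class[OF equiv_V])
  let ?S = "{({t \<in> U'. poly (cpoly q') t \<noteq> 0}, \<lambda>t. (poly (cpoly p') t / poly (cpoly q') t) *s f' t)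
    |U' f' p' q'. (U', f') \<in> V_class U f \<and> q' \<noteq> 0 \<and> Fract p q = Fract p' q'}"
  have "(U, f) \<in> V_class U f"
    using equiv_class_self[OF equiv_V f] .
  then show "?S \<noteq> {}"
    using q by blast
  fix s assume "s \<in> ?S"
  then obtain U' f' p' q'
    where s: "s = ({t \<in> U'. poly (cpoly q') t \<noteq> 0}, \<lambda>t. (poly (cpoly p') t / poly (cpoly q') t) *s f' t)"
      and rel: "((U, f), (U', f')) \<in> rat_rel affine_morphism V"
      and q': "q' \<noteq> 0" "Fract p q = Fract p' q'"
    by blast
  have "p * q' = p' * q"
    using q q' by (simp add: eq_fract)
  then have "cpoly p * cpoly q' = cpoly p' * cpoly q"
    by (metis cpoly_mult)
  then have "poly (cpoly p) t * poly (cpoly q') t = poly (cpoly p') t * poly (cpoly q) t" for t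
    by (metis poly_mult)
  then have ratio: "poly (cpoly p) t / poly (cpoly q) t = poly (cpoly p') t / poly (cpoly q') t"
    if "poly (cpoly q) t \<noteq> 0" "poly (cpoly q') t \<noteq> 0" for t
    using that by (simp add: frac_eq_eq)
  show "(({t \<in> U. poly (cpoly q) t \<noteq> 0}, \<lambda>t. (poly (cpoly p) t / poly (cpoly q) t) *s f t), s)
      \<in> rat_rel affine_morphism V"
    unfolding s
    by (rule rat_relI[OF separated_affine scale_reps[OF f] scale_reps[OF V_relD(1)[OF rel]] zopen_UNIV])
      (use q q' ratio V_relD(2)[OF rel] in \<open>auto simp: cpoly_eq_0_iff\<close>)
qed

section \<open>Nonzero nonnegative maps and surjectivity of \<open>a_tilde\<close>\<close>

lemma V_mapsE:
  assumes "F \<in> V_maps"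
  obtains U f t1 where "F = V_class U f" "(U, f) \<in> rat_reps affine_morphism V"
    "t1 \<in> U" "f t1 \<noteq> 0" "\<forall>\<^sub>F s in at_right 0. f (of_real s) \<in> V_nonneg \<beta>"
proof -
  have "F \<in> rational_maps_nonneg affine_morphism V (V_bullet_nonneg G \<rho> \<eta> \<beta>)"
    using assms by (simp add: V_bullet_K_def)
  then obtain U f where f: "F = V_class U f" "(U, f) \<in> rat_reps affine_morphism V"
    "\<forall>\<^sub>F s in at_right 0. f (of_real s) \<in> V_bullet_nonneg G \<rho> \<eta> \<beta>"
    by (rule rational_maps_nonnegE[OF separated_affine]) blast
  \<comment> \<open>If \<open>f\<close> vanished on all of \<open>U\<close>, it would agree there
    with the constant zero map on \<open>UNIV\<close>, so its class would be
    \<open>zero_map\<close>.\<close>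
  have "\<exists>t1\<in>U. f t1 \<noteq> 0"
  proof (rule ccontr)
    assume "\<not> ?thesis"
    moreover have "(UNIV, \<lambda>_. 0) \<in> rat_reps affine_morphism V"
    proof -
      have "affine_morphism UNIV (\<lambda>_. 0)"
        by (rule affine_morphismI)
          (intro exI[of _ "\<lambda>_. 0"] exI[of _ 1], simp add: polyvec_def vec_eq_iff)
      then show ?thesis
        using zero_in_V zopen_UNIV by (simp add: rat_reps_def)
    qed
    ultimately have "((U, f), (UNIV, \<lambda>_. 0)) \<in> rat_rel affine_morphism V"
      using f(2) by (intro rat_relI[OF separated_affine _ _ zopen_UNIV]) auto
    then have "F = zero_map G \<rho> \<eta>"
      unfolding f(1) zero_map_def by (rule equiv_class_eq[OF equiv_V])
    then show False
      using assms by simp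
  qed
  moreover have "\<forall>\<^sub>F s in at_right 0. f (of_real s) \<in> V_nonneg \<beta>"
    using f(3) by (rule eventually_mono) (simp add: V_bullet_nonneg_def)
  ultimately show thesis
    using that f(1,2) by blast
qed

lemma V_mapsI:
  assumes f: "(U, f) \<in> rat_reps affine_morphism V" "t1 \<in> U" "f t1 \<noteq> 0"
    and nonneg: "\<forall>\<^sub>F s in at_right 0. f (of_real s) \<in> V_nonneg \<beta>"
  shows "V_class U f \<in> V_maps"
proof -
  have "\<forall>\<^sub>F s in at_right 0. f (of_real s) \<in> V_bullet_nonneg G \<rho> \<eta> \<beta>"
    using nonneg zopen_eventually_at_right[OF V_repsD(1)[OF f(1)]]
    by eventually_elim (simp add: V_bullet_nonneg_def V_repsD(3)[OF f(1)])
  then have "V_class U f \<in> V_bullet_K G \<rho> \<eta> \<beta>"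
    unfolding V_bullet_K_def using rational_maps_nonneg_iff[OF separated_affine f(1)] by blast
  moreover have "V_class U f \<noteq> zero_map G \<rho> \<eta>"
  proof
    assume "V_class U f = zero_map G \<rho> \<eta>"
    then have "(U, f) \<in> zero_map G \<rho> \<eta>"
      using equiv_class_self[OF equiv_V f(1)] by simp
    then show False
      using f(2,3) unfolding zero_map_def by (auto simp: rat_rel_def)
  qed
  ultimately show ?thesis
    by simp
qed

text \<open>For small \<open>s\<close> the value of \<open>f\<close> is itself a nonzero nonnegative
  vector on its line, since the support of \<open>f\<close> is cofinite.\<close>

lemma a_tilde_in_P_K:
  assumes "F \<in> V_maps"
  shows "a_tilde G \<rho> \<eta> F \<in> P_bullet_K G \<rho> \<eta> \<beta>"
proof -
  obtain U f t1 where f: "F = V_class U f" "(U, f) \<in> rat_reps affine_morphism V"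
    "t1 \<in> U" "f t1 \<noteq> 0" and nonneg: "\<forall>\<^sub>F s in at_right 0. f (of_real s) \<in> V_nonneg \<beta>"
    using assms by (rule V_mapsE)
  have "\<forall>\<^sub>F s in at_right 0. vec.span {f (of_real s)} \<in> P_bullet_nonneg G \<rho> \<eta> \<beta>"
    using nonneg zopen_eventually_at_right[OF zopen_support[OF f(2-4)]]
  proof eventually_elim
    case (elim s)
    then have "vec.span {f (of_real s)} \<in> P"
      using span_in_P V_repsD(3)[OF f(2)] by simp
    moreover have "f (of_real s) \<in> vec.span {f (of_real s)}"
      by (simp add: vec.span_base)
    ultimately show ?case
      using elim unfolding P_bullet_nonneg_def by blast
  qed
  then show ?thesis
    unfolding f(1) a_tilde_class[OF f(2-4)] P_bullet_K_def
    using rational_maps_nonneg_iff[OF separated_projective span_reps[OF f(2-4)]] by blast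
qed

text \<open>A lift is obtained by dividing homogeneous coordinates by a nonzero \<open>\<beta>\<close>-coordinate: a
  vector on a nonnegative line becomes nonnegative once one of its coordinates is \<open>1\<close>.\<close>

lemma a_tilde_surj:
  assumes "L \<in> P_bullet_K G \<rho> \<eta> \<beta>"
  shows "\<exists>F\<in>V_maps. a_tilde G \<rho> \<eta> F = L"
proof -
  obtain U l where l: "L = P_class U l" "(U, l) \<in> rat_reps projective_morphism P" "zopen U"
    "projective_morphism U l" "\<And>t. t \<in> U \<Longrightarrow> l t \<in> P"
    "\<forall>\<^sub>F s in at_right 0. l (of_real s) \<in> P_bullet_nonneg G \<rho> \<eta> \<beta>"
    using assms unfolding P_bullet_K_def
    by (rule rational_maps_nonnegE[OF separated_projective]) blast
  obtain t0 where "t0 \<in> U"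
    using zopen_nonempty[OF l(3)] ..
  obtain p where p: "polyvec p t0 \<noteq> 0"
    "\<And>t. t \<in> U \<Longrightarrow> polyvec p t \<noteq> 0 \<Longrightarrow> l t = vec.span {polyvec p t}"
    by (rule projective_morphism_local[OF l(4) \<open>t0 \<in> U\<close>]) blast
  \<comment> \<open>\<open>b\<close> is chosen at the single point \<open>t0\<close>. Its coordinate
    polynomial \<open>c\<close> is then nonzero, so the same \<open>b\<close> serves outside
    finitely many points.\<close>
  obtain b where b: "b \<in> \<beta>" "vec.representation \<beta> (polyvec p t0) b \<noteq> 0"
    using representation_nonzeroE[OF independent spanning p(1)] .
  obtain c where c: "\<And>t. vec.representation \<beta> (polyvec p t) b = poly c t"
    by (rule representation_polyvec[OF independent spanning]) blast
  define W where "W = {t \<in> U. poly c t \<noteq> 0}"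
  define f where "f t = inverse (poly c t) *s polyvec p t" for t
  have ne: "polyvec p t \<noteq> 0" if "poly c t \<noteq> 0" for t
    using c[of t] that by (auto simp: vec.representation_zero)
  have l_eq: "l t = vec.span {f t}" "f t \<noteq> 0" if "t \<in> W" for t
    using that ne[of t] p(2)[of t] by (auto simp: W_def f_def span_singleton_scale)
  have "c \<noteq> 0"
    using b(2) c[of t0] by auto
  then have W: "zopen W"
    using zopen_Int[OF l(3) zopen_poly_nonzero] by (simp add: W_def Collect_conj_eq)
  have "f t \<in> V" if "t \<in> W" for t
    using l(5)[of t] l_eq[OF that] that
    by (intro V_memI[of "l t"]) (auto simp: W_def vec.span_base)
  moreover have "affine_morphism W f"
    by (rule affine_morphismI) (auto simp: W_def f_def)
  ultimately have f: "(W, f) \<in> rat_reps affine_morphism V"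
    using W by (simp add: rat_reps_def)
  obtain t1 where t1: "t1 \<in> W" "f t1 \<noteq> 0"
    using zopen_nonempty[OF W] l_eq by blast
  have "\<forall>\<^sub>F s in at_right 0. f (of_real s) \<in> V_nonneg \<beta>"
    using zopen_eventually_at_right[OF W] l(6)
  proof eventually_elim
    case (elim s)
    let ?r = "vec.representation \<beta> (polyvec p (of_real s))"
    have s: "complex_of_real s \<in> U" "poly c (of_real s) \<noteq> 0"
      using elim by (auto simp: W_def)
    obtain u where u: "u \<in> l (of_real s)" "u \<noteq> 0" "u \<in> V_nonneg \<beta>"
      using elim by (auto simp: P_bullet_nonneg_def)
    then obtain z where z: "u = z *s polyvec p (of_real s)"
      using p(2)[OF s(1) ne[OF s(2)]] by (auto simp: vec_span_singleton)
    then have "z \<noteq> 0"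
      using u(2) by auto
    have nonneg: "z * ?r b' \<in> \<real>\<^sub>\<ge>\<^sub>0" if "b' \<in> \<beta>" for b'
      using u(3) that z by (auto simp: V_nonneg_def representation_scale)
    show ?case
      unfolding V_nonneg_def
    proof (intro CollectI ballI)
      fix b' assume "b' \<in> \<beta>"
      \<comment> \<open>The unknown scalar \<open>z\<close> cancels. Numerator and denominator are
        coordinates of the nonnegative vector \<open>u\<close>.\<close>
      have "vec.representation \<beta> (f (of_real s)) b' = (z * ?r b') / (z * ?r b)"
        using s(2) \<open>z \<noteq> 0\<close> by (simp add: f_def representation_scale c divide_inverse)
      then show "vec.representation \<beta> (f (of_real s)) b' \<in> \<real>\<^sub>\<ge>\<^sub>0"
        using nonneg_Reals_divide_I[OF nonneg[OF \<open>b' \<in> \<beta>\<close>] nonneg[OF b(1)]] by (simp only:)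
    qed
  qed
  then have "V_class W f \<in> V_maps"
    by (rule V_mapsI[OF f t1])
  moreover have "(({t \<in> W. f t \<noteq> 0}, \<lambda>t. vec.span {f t}), (U, l)) \<in> rat_rel projective_morphism P"
    using l_eq by (intro rat_relI[OF separated_projective span_reps[OF f t1] l(2) zopen_UNIV]) auto
  then have "a_tilde G \<rho> \<eta> (V_class W f) = L"
    unfolding l(1) a_tilde_class[OF f t1] by (rule equiv_class_eq[OF equiv_P])
  ultimately show ?thesis
    by blast
qed

section \<open>The fibres of \<open>a_tilde\<close> as orbits of the semifield\<close>

lemma K_act_fibre:
  assumes "F \<in> V_maps" "k \<in> K_semifield"
  shows "K_act G \<rho> \<eta> k F \<in> V_maps" "a_tilde G \<rho> \<eta> (K_act G \<rho> \<eta> k F) = a_tilde G \<rho> \<eta> F"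
proof -
  obtain U f t1 where f: "F = V_class U f" "(U, f) \<in> rat_reps affine_morphism V"
    "t1 \<in> U" "f t1 \<noteq> 0" and nonneg: "\<forall>\<^sub>F s in at_right 0. f (of_real s) \<in> V_nonneg \<beta>"
    using assms(1) by (rule V_mapsE)
  obtain p q where k: "q \<noteq> 0" "k = Fract p q"
    and pos: "\<forall>\<^sub>F s in at_right 0. poly p s > 0" "\<forall>\<^sub>F s in at_right 0. poly q s > 0"
    using assms(2) by (rule K_semifieldD)
  have "p \<noteq> 0"
    using pos(1) by auto
  define U' where "U' = {t \<in> U. poly (cpoly q) t \<noteq> 0}"
  define f' where "f' t = (poly (cpoly p) t / poly (cpoly q) t) *s f t" for t
  have f': "(U', f') \<in> rat_reps affine_morphism V"
    unfolding U'_def f'_def using scale_reps[OF f(2)] k(1) by (simp add: cpoly_eq_0_iff)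
  have kF: "K_act G \<rho> \<eta> k F = V_class U' f'"
    unfolding f(1) k(2) U'_def f'_def using K_act_class[OF f(2) k(1)] .
  \<comment> \<open>A point where \<open>f\<close>, numerator and denominator are all nonzero shows
    that the scaled map is not zero.\<close>
  have "zopen ({t \<in> U. f t \<noteq> 0} \<inter> {t. poly (cpoly p) t \<noteq> 0} \<inter> {t. poly (cpoly q) t \<noteq> 0})"
    (is "zopen ?W")
    using \<open>p \<noteq> 0\<close> k(1) zopen_support[OF f(2-4)]
    by (intro zopen_Int zopen_poly_nonzero) (simp_all add: cpoly_eq_0_iff)
  then obtain t2 where "t2 \<in> ?W"
    using zopen_nonempty by blast
  then have t2: "t2 \<in> U'" "f' t2 \<noteq> 0"
    by (auto simp: U'_def f'_def)
  have "\<forall>\<^sub>F s in at_right 0. f' (of_real s) \<in> V_nonneg \<beta>"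
    using nonneg pos
  proof eventually_elim
    case (elim s)
    have "poly (cpoly p) (of_real s) / poly (cpoly q) (of_real s) = of_real (poly p s / poly q s)"
      by (simp add: poly_cpoly_of_real)
    then have "poly (cpoly p) (of_real s) / poly (cpoly q) (of_real s) \<in> \<real>\<^sub>\<ge>\<^sub>0"
      using elim(2,3) by (simp only: nonneg_Reals_of_real_iff) simp
    with elim(1) show ?case
      unfolding f'_def by (rule V_nonneg_scale[OF independent spanning])
  qed
  then show "K_act G \<rho> \<eta> k F \<in> V_maps"
    unfolding kF by (rule V_mapsI[OF f' t2])
  have "(({t \<in> U'. f' t \<noteq> 0}, \<lambda>t. vec.span {f' t}), ({t \<in> U. f t \<noteq> 0}, \<lambda>t. vec.span {f t}))
      \<in> rat_rel projective_morphism P"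
    by (rule rat_relI[OF separated_projective span_reps[OF f' t2] span_reps[OF f(2-4)] zopen_UNIV])
      (auto simp: f'_def span_singleton_scale)
  then show "a_tilde G \<rho> \<eta> (K_act G \<rho> \<eta> k F) = a_tilde G \<rho> \<eta> F"
    unfolding kF a_tilde_class[OF f' t2] unfolding f(1) a_tilde_class[OF f(2-4)]
    by (rule equiv_class_eq[OF equiv_P])
qed

text \<open>Equality of lines gives only a pointwise scalar between the two maps. Reading it off at
  one basis element shows that it is rational, and nonnegativity of both coordinates shows that it
  is positive near 0.\<close>

lemma a_tilde_eqD:
  assumes "F \<in> V_maps" "F' \<in> V_maps" "a_tilde G \<rho> \<eta> F = a_tilde G \<rho> \<eta> F'"
  shows "\<exists>k\<in>K_semifield. F' = K_act G \<rho> \<eta> k F"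
proof -
  obtain U f t1 where f: "F = V_class U f" "(U, f) \<in> rat_reps affine_morphism V"
    "t1 \<in> U" "f t1 \<noteq> 0" and nonneg: "\<forall>\<^sub>F s in at_right 0. f (of_real s) \<in> V_nonneg \<beta>"
    using assms(1) by (rule V_mapsE)
  obtain U' f' t1' where f': "F' = V_class U' f'" "(U', f') \<in> rat_reps affine_morphism V"
    "t1' \<in> U'" "f' t1' \<noteq> 0" and nonneg': "\<forall>\<^sub>F s in at_right 0. f' (of_real s) \<in> V_nonneg \<beta>"
    using assms(2) by (rule V_mapsE)
  have "(({t \<in> U. f t \<noteq> 0}, \<lambda>t. vec.span {f t}), ({t \<in> U'. f' t \<noteq> 0}, \<lambda>t. vec.span {f' t}))
      \<in> rat_rel projective_morphism P"
    using assms(3) unfolding f(1) f'(1) a_tilde_class[OF f(2-4)] a_tilde_class[OF f'(2-4)]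
    by (rule eq_equiv_class[OF _ equiv_P span_reps[OF f'(2-4)]])
  then have spans: "vec.span {f t} = vec.span {f' t}"
    if "t \<in> U" "t \<in> U'" "f t \<noteq> 0" "f' t \<noteq> 0" for t
    using that by (auto simp: rat_rel_def)
  obtain p q where pq: "poly q t1 \<noteq> 0"
    "\<And>t. t \<in> U \<Longrightarrow> poly q t \<noteq> 0 \<Longrightarrow> f t = inverse (poly q t) *s polyvec p t"
    by (rule affine_morphism_local[OF V_repsD(2)[OF f(2)] f(3)]) blast
  obtain p' q' where pq': "poly q' t1' \<noteq> 0"
    "\<And>t. t \<in> U' \<Longrightarrow> poly q' t \<noteq> 0 \<Longrightarrow> f' t = inverse (poly q' t) *s polyvec p' t"
    by (rule affine_morphism_local[OF V_repsD(2)[OF f'(2)] f'(3)]) blast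
  have "polyvec p t1 \<noteq> 0"
    using pq(2)[OF f(3) pq(1)] f(4) by auto
  \<comment> \<open>\<open>b\<close> is chosen from the first map alone. On the set \<open>W\<close>
    below, the second map is a nonzero multiple of the first, so its coordinate at \<open>b\<close>
    is nonzero there too.\<close>
  then obtain b where b: "b \<in> \<beta>" "vec.representation \<beta> (polyvec p t1) b \<noteq> 0"
    using representation_nonzeroE[OF independent spanning] by blast
  obtain c where c: "\<And>t. vec.representation \<beta> (polyvec p t) b = poly c t"
    by (rule representation_polyvec[OF independent spanning]) blast
  obtain c' where c': "\<And>t. vec.representation \<beta> (polyvec p' t) b = poly c' t"
    by (rule representation_polyvec[OF independent spanning]) blast
  have ne: "c \<noteq> 0" "q \<noteq> 0" "q' \<noteq> 0"
    using b(2) c[of t1] pq(1) pq'(1) by auto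
  define W where "W = {t \<in> U. f t \<noteq> 0} \<inter> {t \<in> U'. f' t \<noteq> 0} \<inter> {t. poly q t \<noteq> 0} \<inter> {t. poly q' t \<noteq> 0}
    \<inter> {t. poly c t \<noteq> 0}"
  have W: "zopen W"
    unfolding W_def
    using ne zopen_support[OF f(2-4)] zopen_support[OF f'(2-4)]
    by (intro zopen_Int zopen_poly_nonzero)
  \<comment> \<open>\<open>a / d\<close> is the quotient of the coordinates \<open>c' / q'\<close>
    and \<open>c / q\<close> with the inner fractions cleared.\<close>
  define a d where "a = c' * q" and "d = q' * c"
  have "d \<noteq> 0"
    using ne by (simp add: d_def)
  have ratio: "poly d t \<noteq> 0" "poly a t / poly d t \<noteq> 0" "f' t = (poly a t / poly d t) *s f t"
    "vec.representation \<beta> (f t) b \<noteq> 0"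
    if "t \<in> W" for t
  proof -
    have t: "t \<in> U" "t \<in> U'" "f t \<noteq> 0" "f' t \<noteq> 0" "poly q t \<noteq> 0" "poly q' t \<noteq> 0" "poly c t \<noteq> 0"
      using that by (auto simp: W_def)
    obtain z where z: "z \<noteq> 0" "f' t = z *s f t"
      using span_singleton_eqE[OF spans[OF t(1-4), symmetric] t(4)] .
    have r: "vec.representation \<beta> (f t) b = poly c t / poly q t"
      "vec.representation \<beta> (f' t) b = poly c' t / poly q' t"
      using pq(2)[OF t(1,5)] pq'(2)[OF t(2,6)]
      by (simp_all add: representation_scale c c' divide_inverse)
    have "poly c' t / poly q' t = z * (poly c t / poly q t)"
      using r z(2) by (simp add: representation_scale)
    then have "z = poly a t / poly d t"
      using t by (simp add: a_def d_def field_simps)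
    with z show "poly a t / poly d t \<noteq> 0" "f' t = (poly a t / poly d t) *s f t"
      by auto
    show "poly d t \<noteq> 0" "vec.representation \<beta> (f t) b \<noteq> 0"
      using t r by (auto simp: d_def)
  qed
  have pos: "\<forall>\<^sub>F s in at_right 0. \<exists>x>0. poly a (of_real s) = of_real x * poly d (of_real s)"
    using nonneg nonneg' zopen_eventually_at_right[OF W]
  proof eventually_elim
    case (elim s)
    let ?z = "poly a (of_real s) / poly d (of_real s)"
    let ?r = "\<lambda>u. vec.representation \<beta> u b"
    have "?r (f' (of_real s)) / ?r (f (of_real s)) \<in> \<real>\<^sub>\<ge>\<^sub>0"
      using elim(1,2) b(1) by (intro nonneg_Reals_divide_I) (auto simp: V_nonneg_def)
    also have "?r (f' (of_real s)) = ?z * ?r (f (of_real s))"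
      by (subst ratio(3)[OF elim(3)]) (simp only: representation_scale)
    finally have "?z \<in> \<real>\<^sub>\<ge>\<^sub>0"
      using ratio(4)[OF elim(3)] by simp
    then obtain x where "?z = of_real x" "x \<ge> 0"
      by (auto elim: nonneg_Reals_cases)
    with ratio(1,2)[OF elim(3)] show ?case
      by (intro exI[of _ x]) (auto simp: field_simps)
  qed
  obtain m n where mn: "n \<noteq> 0" "Fract m n \<in> K_semifield" "cpoly m * d = cpoly n * a"
    by (rule positive_ratio_in_K[OF \<open>d \<noteq> 0\<close> pos]) blast
  have n: "cpoly n \<noteq> 0"
    using mn(1) by (simp add: cpoly_eq_0_iff)
  have "poly (cpoly m) t * poly d t = poly (cpoly n) t * poly a t" for t
    using mn(3) by (metis poly_mult)
  then have "poly (cpoly m) t / poly (cpoly n) t = poly a t / poly d t"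
    if "poly (cpoly n) t \<noteq> 0" "poly d t \<noteq> 0" for t
    using that by (simp add: frac_eq_eq mult.commute)
  \<comment> \<open>The equality is known on \<open>W\<close>; \<open>rat_relI\<close> carries it
    over to the whole common domain.\<close>
  then have "(({t \<in> U. poly (cpoly n) t \<noteq> 0}, \<lambda>t. (poly (cpoly m) t / poly (cpoly n) t) *s f t),
      (U', f')) \<in> rat_rel affine_morphism V"
    by (intro rat_relI[OF separated_affine scale_reps[OF f(2) n] f'(2) W])
      (auto simp: ratio(1) ratio(3))
  then have "K_act G \<rho> \<eta> (Fract m n) F = F'"
    unfolding f(1) f'(1) K_act_class[OF f(2) mn(1)] by (rule equiv_class_eq[OF equiv_V])
  then show ?thesis
    using mn(2) by blast
qed

text \<open>\<open>K_act_fibre\<close> gives one inclusion and \<open>a_tilde_eqD\<close> the other.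
  Being fibres of one map, the orbits partition \<open>V_maps\<close>; this takes the place of a
  verification of the action laws.\<close>

lemma orbit_eq_fibre:
  assumes "F \<in> V_maps"
  shows "orbit K_mult (K_act G \<rho> \<eta>) F = {F' \<in> V_maps. a_tilde G \<rho> \<eta> F' = a_tilde G \<rho> \<eta> F}"
  using K_act_fibre[OF assms] a_tilde_eqD[OF assms] unfolding orbit_def K_mult_def by fastforce

lemma a_tilde_quotient_bij:
  "a_tilde G \<rho> \<eta> ` V_maps = P_bullet_K G \<rho> \<eta> \<beta> \<and>
    (\<exists>\<Phi>. (\<forall>F\<in>V_maps. \<Phi> (orbit K_mult (K_act G \<rho> \<eta>) F) = a_tilde G \<rho> \<eta> F) \<and>
      bij_betw \<Phi> (orbits K_mult V_maps (K_act G \<rho> \<eta>)) (P_bullet_K G \<rho> \<eta> \<beta>))"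
proof (intro conjI exI)
  show image: "a_tilde G \<rho> \<eta> ` V_maps = P_bullet_K G \<rho> \<eta> \<beta>"
    using a_tilde_in_P_K a_tilde_surj by blast
  \<comment> \<open>On an orbit \<open>a_tilde\<close> is constant, so its image is a singleton and
    \<open>the_elem\<close> returns the common value.\<close>
  define \<Phi> where "\<Phi> S = the_elem (a_tilde G \<rho> \<eta> ` S)" for S
  have \<Phi>: "\<Phi> (orbit K_mult (K_act G \<rho> \<eta>) F) = a_tilde G \<rho> \<eta> F" if "F \<in> V_maps" for F
  proof -
    have "a_tilde G \<rho> \<eta> ` orbit K_mult (K_act G \<rho> \<eta>) F = {a_tilde G \<rho> \<eta> F}"
      unfolding orbit_eq_fibre[OF that] using that by blast
    then show ?thesis
      by (simp add: \<Phi>_def)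
  qed
  then show "\<forall>F\<in>V_maps. \<Phi> (orbit K_mult (K_act G \<rho> \<eta>) F) = a_tilde G \<rho> \<eta> F"
    by blast
  show "bij_betw \<Phi> (orbits K_mult V_maps (K_act G \<rho> \<eta>)) (P_bullet_K G \<rho> \<eta> \<beta>)"
  proof (rule bij_betw_imageI)
    show "inj_on \<Phi> (orbits K_mult V_maps (K_act G \<rho> \<eta>))"
    proof (rule inj_onI)
      fix S S' assume "S \<in> orbits K_mult V_maps (K_act G \<rho> \<eta>)" "S' \<in> orbits K_mult V_maps (K_act G \<rho> \<eta>)"
      then obtain F F' where F: "F \<in> V_maps" "S = orbit K_mult (K_act G \<rho> \<eta>) F"
        "F' \<in> V_maps" "S' = orbit K_mult (K_act G \<rho> \<eta>) F'"
        unfolding orbits_def by blast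
      assume "\<Phi> S = \<Phi> S'"
      then have "a_tilde G \<rho> \<eta> F = a_tilde G \<rho> \<eta> F'"
        unfolding F(2,4) \<Phi>[OF F(1)] \<Phi>[OF F(3)] .
      then show "S = S'"
        unfolding F(2,4) orbit_eq_fibre[OF F(1)] orbit_eq_fibre[OF F(3)] by simp
    qed
    have "\<Phi> ` orbits K_mult V_maps (K_act G \<rho> \<eta>) = a_tilde G \<rho> \<eta> ` V_maps"
      using \<Phi> unfolding orbits_def image_def by blast
    then show "\<Phi> ` orbits K_mult V_maps (K_act G \<rho> \<eta>) = P_bullet_K G \<rho> \<eta> \<beta>"
      using image by simp
  qed
qed

end

theorem mainTheorem6:
  fixes G B T :: "(complex^'n^'n) set"
    and I :: "'i set"
    and \<alpha> :: "'i \<Rightarrow> complex^'n^'n \<Rightarrow> complex"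
    and h x y :: "'i \<Rightarrow> complex \<Rightarrow> complex^'n^'n"
    and lam :: "complex^'n^'n \<Rightarrow> complex"
    and \<rho> :: "complex^'n^'n \<Rightarrow> complex^'d^'d"
    and \<eta> :: "complex^'d"
    and \<beta> :: "(complex^'d) set"
  assumes "connected_semisimple G"
    and "pinning G B T I \<alpha> h x y"
    and "simply_laced I (cartan_matrix \<alpha> h)"
    and "simply_connected_type T I h"
    and "lam \<in> dominant_regular T I h"
    and "simple_module G \<rho>"
    and "highest_weight_vector B T \<rho> lam \<eta>"
    and "canonical_basis I (cartan_matrix \<alpha> h) (chevalley_f \<rho> y) \<eta> \<beta>"
  shows "a_tilde G \<rho> \<eta> ` (V_bullet_K G \<rho> \<eta> \<beta> - {zero_map G \<rho> \<eta>}) = P_bullet_K G \<rho> \<eta> \<beta> \<and>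
    (\<exists>\<Phi>. (\<forall>F \<in> V_bullet_K G \<rho> \<eta> \<beta> - {zero_map G \<rho> \<eta>}.
            \<Phi> (orbit K_mult (K_act G \<rho> \<eta>) F) = a_tilde G \<rho> \<eta> F) \<and>
         bij_betw \<Phi> (orbits K_mult (V_bullet_K G \<rho> \<eta> \<beta> - {zero_map G \<rho> \<eta>}) (K_act G \<rho> \<eta>))
           (P_bullet_K G \<rho> \<eta> \<beta>))"
proof -
  \<comment> \<open>Invertible matrices send the line of \<eta> to lines, the identity of
    \<open>G\<close> makes the family nonempty, and the basis property is part of
    \<open>canonical_basis\<close>.\<close>
  interpret line_family G \<rho> \<eta> \<beta>
  proof
    show "\<exists>v. v \<noteq> 0 \<and> L = vec.span {v}" if L: "L \<in> P_bullet G \<rho> \<eta>" for L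
    proof -
      obtain g where g: "g \<in> G" "L = (\<lambda>u. \<rho> g *v u) ` vec.span {\<eta>}"
        using L by (auto simp: P_bullet_def)
      have "\<rho> g \<in> GL"
        using assms(6) g(1)
        by (auto simp: simple_module_def algebraic_hom_def mat_group_def hom_def)
      then have "\<rho> g *v \<eta> \<noteq> 0"
        using assms(7)
        by (metis GL_def highest_weight_vector_def invertible_def matrix_vector_mul_assoc
            matrix_vector_mul_lid matrix_vector_mult_0_right mem_Collect_eq)
      moreover have "L = vec.span {\<rho> g *v \<eta>}"
        unfolding g(2) vec_span_singleton image_image by (simp add: vector_scalar_commute)
      ultimately show ?thesis
        by blast
    qed
    have "mat 1 \<in> G"
      using assms(1) subgroup.one_closed[of G "mat_group GL"]
      by (simp add: connected_semisimple_def algebraic_group_def mat_group_def)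
    then show "P_bullet G \<rho> \<eta> \<noteq> {}"
      unfolding P_bullet_def by blast
    show "vec.independent \<beta>" "vec.span \<beta> = UNIV"
      using assms(8) by (auto simp: canonical_basis_def)
  qed
  show ?thesis
    by (rule a_tilde_quotient_bij)
qed

end
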